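(* Let $\Delta$ and $\Delta'$ be shellable simplicial spheres. If the facet-ridge graph of $\Delta$ is isomorphic (as a graph) to the facet-ridge graph of $\Delta'$, then $\Delta$ and $\Delta'$ are isomorphic simplicial complexes, i.e., there is a bijection between their vertex sets mapping the faces of $\Delta$ exactly onto the faces of $\Delta'$. In other words, the combinatorial structure of a shellable simplicial sphere is determined by its facet-ridge graph.
   Context: A simplicial complex $\Delta$ on a finite set $V$ is a family of subsets of $V$ (faces) containing all singletons $\{v\}$, $v\in V$, and closed under taking subsets; $\dim\sigma=|\sigma|-1$. $\Delta$ is pure $(d-1)$-dimensional if all its inclusion-maximal faces (facets) have dimension $d-1$; faces of dimension $d-2$ are ridges. The facet-ridge graph of a pure $(d-1)$-dimensional complex has the facets as vertices, two facets being adjacent iff their intersection is a ridge. For a face $\sigma$, $\overline{\sigma}$ denotes the set of all subsets of $\sigma$. A shelling is a total ordering $T_1,\dots,T_n$ of the facets such that for every $2\le i\le n$, $\overline{T}_i\cap(\overline{T}_1\cup\cdots\cup\overline{T}_{i-1})$ is a pure $(d-2)$-dimensional simplicial complex; $\Delta$ is shellable if a shelling exists. A simplicial sphere is a simplicial complex whose geometric realization is homeomorphic to a sphere. *)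

theory Defs
  imports "HOL-Analysis.Analysis"
begin

definition simplicial_complex :: "'a set \<Rightarrow> 'a set set \<Rightarrow> bool" where
  "simplicial_complex V \<Delta> \<longleftrightarrow> finite V \<and> (\<forall>\<sigma>\<in>\<Delta>. \<sigma> \<subseteq> V) \<and>
     (\<forall>v\<in>V. {v} \<in> \<Delta>) \<and> (\<forall>\<sigma>\<in>\<Delta>. \<forall>\<tau>. \<tau> \<subseteq> \<sigma> \<longrightarrow> \<tau> \<in> \<Delta>)"

definition facets :: "'a set set \<Rightarrow> 'a set set" where
  "facets \<Delta> = {\<sigma>\<in>\<Delta>. \<forall>\<tau>\<in>\<Delta>. \<sigma> \<subseteq> \<tau> \<longrightarrow> \<tau> = \<sigma>}"

definition pure_card :: "'a set set \<Rightarrow> nat \<Rightarrow> bool" where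
  "pure_card \<Delta> d \<longleftrightarrow> (\<forall>F\<in>facets \<Delta>. card F = d)"

definition closure_face :: "'a set \<Rightarrow> 'a set set" where
  "closure_face \<sigma> = Pow \<sigma>"

definition shelling :: "'a set set \<Rightarrow> nat \<Rightarrow> 'a set list \<Rightarrow> bool" where
  "shelling \<Delta> d Ts \<longleftrightarrow> distinct Ts \<and> set Ts = facets \<Delta> \<and>
     (\<forall>i. 1 \<le> i \<and> i < length Ts \<longrightarrow>
        pure_card (closure_face (Ts ! i) \<inter> (\<Union>j<i. closure_face (Ts ! j))) (d - 1))"

definition shellable :: "'a set set \<Rightarrow> bool" where
  "shellable \<Delta> \<longleftrightarrow> (\<exists>d Ts. d \<ge> 1 \<and> pure_card \<Delta> d \<and> shelling \<Delta> d Ts)"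

text \<open>Geometric realization: points are functions 'a \<Rightarrow> real (barycentric coordinates),
  nonnegative, summing to 1, whose support is a face; topology inherited from the
  product topology on 'a \<Rightarrow> real (Euclidean on the finite coordinate set V).\<close>
definition geom_realization :: "'a set set \<Rightarrow> ('a \<Rightarrow> real) set" where
  "geom_realization \<Delta> = {x. (\<forall>v. 0 \<le> x v) \<and> {v. x v \<noteq> 0} \<in> \<Delta> \<and>
       finite {v. x v \<noteq> 0} \<and> sum x {v. x v \<noteq> 0} = 1}"

definition simplicial_sphere :: "'a set \<Rightarrow> 'a set set \<Rightarrow> bool" where
  "simplicial_sphere V \<Delta> \<longleftrightarrow> simplicial_complex V \<Delta> \<and>
     (\<exists>n. subtopology (powertop_real UNIV) (geom_realization \<Delta>) homeomorphic_space nsphere n)"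

text \<open>Facet-ridge graph adjacency (for a pure complex): two distinct facets whose
  intersection is a ridge, i.e. has one element less than a facet.\<close>
definition fr_adj :: "'a set set \<Rightarrow> 'a set \<Rightarrow> 'a set \<Rightarrow> bool" where
  "fr_adj \<Delta> F G \<longleftrightarrow> F \<in> facets \<Delta> \<and> G \<in> facets \<Delta> \<and> F \<noteq> G \<and> card (F \<inter> G) + 1 = card F"

definition fr_graph_iso :: "'a set set \<Rightarrow> 'b set set \<Rightarrow> bool" where
  "fr_graph_iso \<Delta> \<Delta>' \<longleftrightarrow> (\<exists>f. bij_betw f (facets \<Delta>) (facets \<Delta>') \<and>
     (\<forall>F\<in>facets \<Delta>. \<forall>G\<in>facets \<Delta>. fr_adj \<Delta> F G \<longleftrightarrow> fr_adj \<Delta>' (f F) (f G)))"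

definition complex_iso :: "'a set \<Rightarrow> 'a set set \<Rightarrow> 'b set \<Rightarrow> 'b set set \<Rightarrow> bool" where
  "complex_iso V \<Delta> V' \<Delta>' \<longleftrightarrow> (\<exists>g. bij_betw g V V' \<and> (image g) ` \<Delta> = \<Delta>')"

end

theory Submission
  imports Defs "HOL-Homology.Invariance_of_Domain"
begin

text \<open>The cone over a simplicial sphere is homeomorphic to a Euclidean space, so invariance of domain
  shows that every ridge lies in exactly two facets. Hence the vertices of a facet correspond to
  its neighbours in the facet-ridge graph, and a graph isomorphism identifies the vertices of each
  facet \<open>y\<close> with those of its partner. The claim is that these identifications agree on adjacent
  facets.

  Fix a shelling of the first complex. The facets around a face of codimension two form a cycle,
  which has a single source and hence a single sink. By induction along the shelling, agreement is
  shown around all such cycles with sink \<open>t\<close>. The cycles with earlier sinks generate the cycle space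
  of the graph on the facets before \<open>t\<close>. So for every vertex \<open>a\<close> and every vertex \<open>\<alpha>\<close> of the second
  complex, the predicate that \<open>a\<close> is identified with \<open>\<alpha>\<close> in \<open>y\<close>, defined a priori only if \<open>a\<close> lies
  in \<open>y\<close>, extends to all earlier facets in such a way that it only changes across ridges containing
  \<open>a\<close>. Since the same order has a single source on each vertex star of the second complex (a
  counting argument due to Kalai), the extension is also correct on all facets whose partners
  contain \<open>\<alpha>\<close>. A disagreement around a cycle with sink \<open>t\<close> would then force a third facet to
  contain a ridge.\<close>

section \<open>Invariance of domain for coordinate subspaces\<close>

text \<open>Vanishing outside \<open>I\<close> keeps all these spaces inside one function space, so
  that they carry subspace topologies and the Euclidean space is the case
  \<open>{..<n}\<close>.\<close>

definition coord_space :: "'i set \<Rightarrow> ('i \<Rightarrow> real) set" where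
  "coord_space I = {x. \<forall>i. i \<notin> I \<longrightarrow> x i = 0}"

lemma Euclidean_space_eq_coord_space: "Euclidean_space n = top_of_set (coord_space {..<n})"
proof -
  have "{x :: nat \<Rightarrow> real. \<forall>i\<ge>n. x i = 0} = coord_space {..<n}"
    by (auto simp: coord_space_def)
  then show ?thesis by (simp add: Euclidean_space_def euclidean_product_topology)
qed

lemma homeomorphism_reindex:
  fixes b :: "'i \<Rightarrow> 'j"
  assumes "bij_betw b I J"
  shows "homeomorphism (coord_space J) (coord_space I)
    (\<lambda>x i. if i \<in> I then x (b i) else 0) (\<lambda>x j. if j \<in> J then x (inv_into I b j) else 0)"
proof
  show "continuous_on (coord_space J) (\<lambda>x i. if i \<in> I then x (b i) else (0::real))"
  proof (rule continuous_on_coordinatewise_then_product)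
    fix i show "continuous_on (coord_space J) (\<lambda>x. if i \<in> I then x (b i) else (0::real))"
      by (cases "i \<in> I") (auto intro: continuous_on_subset[OF continuous_on_product_coordinates])
  qed
  show "continuous_on (coord_space I) (\<lambda>x j. if j \<in> J then x (inv_into I b j) else (0::real))"
  proof (rule continuous_on_coordinatewise_then_product)
    fix j show "continuous_on (coord_space I) (\<lambda>x. if j \<in> J then x (inv_into I b j) else (0::real))"
      by (cases "j \<in> J") (auto intro: continuous_on_subset[OF continuous_on_product_coordinates])
  qed
qed (use assms in \<open>auto simp: coord_space_def bij_betw_def fun_eq_iff inv_into_into f_inv_into_f\<close>)

lemma invariance_of_domain_coord_space_nat:
  fixes n :: nat
  assumes U: "openin (top_of_set (coord_space {..<n})) U"
    and f: "continuous_on U f" "f ` U \<subseteq> coord_space {..<n}" "inj_on f U"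
  shows "openin (top_of_set (coord_space {..<n})) (f ` U)"
proof -
  have "coord_space {..<n} \<inter> U = U" using openin_imp_subset[OF U] by blast
  then have "continuous_map (subtopology (Euclidean_space n) U) (Euclidean_space n) f"
    unfolding Euclidean_space_eq_coord_space using f
    by (simp add: subtopology_subtopology continuous_map_in_subtopology image_subset_iff_funcset)
  then show ?thesis
    using invariance_of_domain_Euclidean_space[of n U f] U f(3)
    unfolding Euclidean_space_eq_coord_space by blast
qed

text \<open>Reindexing both sides by \<open>{..<n}\<close> reduces this to the Euclidean case; the
  two index sets may live in different types.\<close>

lemma invariance_of_domain_coord_space:
  assumes fin: "finite I" "finite J" "card I = card J"
    and U: "openin (top_of_set (coord_space I)) U"
    and f: "continuous_on U f" "f ` U \<subseteq> coord_space J" "inj_on f U"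
  shows "openin (top_of_set (coord_space J)) (f ` U)"
proof -
  define n where "n = card I"
  obtain b where b: "bij_betw b {..<n} I"
    using fin(1) unfolding n_def by (metis bij_betw_from_nat_into_finite)
  obtain c where c: "bij_betw c {..<n} J"
    using fin(2,3) unfolding n_def by (metis bij_betw_from_nat_into_finite)
  obtain p p' where p: "homeomorphism (coord_space I) (coord_space {..<n}) p p'"
    using homeomorphism_reindex[OF b] by blast
  obtain q q' where q: "homeomorphism (coord_space J) (coord_space {..<n}) q q'"
    using homeomorphism_reindex[OF c] by blast
  have UI: "U \<subseteq> coord_space I" using U openin_imp_subset by blast
  have pp: "p' (p u) = u" if "u \<in> U" for u
    using homeomorphism_apply1[OF p] UI that by blast
  have "openin (top_of_set (coord_space {..<n})) (p ` U)"
    by (rule homeomorphism_imp_open_map[OF p U])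
  moreover have "continuous_on (p ` U) (q \<circ> f \<circ> p')"
  proof (intro continuous_on_compose)
    show "continuous_on (p ` U) p'"
      using homeomorphism_cont2[OF p] homeomorphism_image1[OF p] UI
      by (metis continuous_on_subset image_mono)
    show "continuous_on (p' ` p ` U) f" "continuous_on (f ` p' ` p ` U) q"
      using f homeomorphism_cont1[OF q] pp by (auto simp: image_image intro: continuous_on_subset)
  qed
  moreover have "(q \<circ> f \<circ> p') ` p ` U = q ` f ` U"
    using pp by (auto simp: image_iff)
  moreover have "q ` f ` U \<subseteq> coord_space {..<n}" using homeomorphism_image1[OF q] f(2) by blast
  moreover have "inj_on (q \<circ> f \<circ> p') (p ` U)"
  proof (rule inj_onI)
    fix x y assume "x \<in> p ` U" "y \<in> p ` U" and eq: "(q \<circ> f \<circ> p') x = (q \<circ> f \<circ> p') y"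
    then obtain u v where uv: "u \<in> U" "v \<in> U" "x = p u" "y = p v" by blast
    then have "q (f u) = q (f v)" using eq pp by simp
    then have "f u = f v" using homeomorphism_apply1[OF q] f(2) uv by (metis imageI subsetD)
    then show "x = y" using f(3) uv by (auto dest: inj_onD)
  qed
  ultimately have "openin (top_of_set (coord_space {..<n})) (q ` f ` U)"
    using invariance_of_domain_coord_space_nat[of n "p ` U" "q \<circ> f \<circ> p'"] by simp
  then have "openin (top_of_set (coord_space J)) (q' ` q ` f ` U)"
    by (rule homeomorphism_imp_open_map[OF homeomorphism_symD[OF q]])
  moreover have "q' ` q ` f ` U = f ` U"
    using homeomorphism_apply1[OF q] f(2) by (force simp: image_image image_iff)
  ultimately show ?thesis by simp
qed

text \<open>Serves to refute openness: a set that constrains coordinate \<open>i\<close> is left by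
  a small change of that coordinate alone.\<close>

lemma openin_coord_space_update:
  assumes "openin (top_of_set (coord_space I)) W" "w \<in> W" "i \<in> I"
  obtains e where "e > 0" "\<And>s. \<bar>s - w i\<bar> < e \<Longrightarrow> w(i := s) \<in> W"
proof -
  have wI: "w \<in> coord_space I" using assms openin_imp_subset by blast
  have cont: "continuous_on UNIV (\<lambda>s. w(i := s))"
  proof (rule continuous_on_coordinatewise_then_product)
    fix j show "continuous_on UNIV (\<lambda>s. (w(i := s)) j)" by (cases "j = i") auto
  qed
  have "(\<lambda>s. w(i := s)) \<in> UNIV \<rightarrow> coord_space I"
    using wI assms(3) by (auto simp: coord_space_def)
  then have "openin (top_of_set UNIV) (UNIV \<inter> (\<lambda>s. w(i := s)) -` W)"
    by (rule continuous_openin_preimage[OF cont _ assms(1)])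
  then have "open ((\<lambda>s. w(i := s)) -` W)" by simp
  moreover have "w i \<in> (\<lambda>s. w(i := s)) -` W" using assms(2) by simp
  ultimately obtain e where "e > 0" "\<And>s. dist s (w i) < e \<Longrightarrow> s \<in> (\<lambda>s. w(i := s)) -` W"
    by (metis open_dist)
  then show ?thesis using that by (simp add: dist_real_def)
qed

text \<open>Invariance of dimension. If \<open>J\<close> were smaller, its space could be placed
  inside a proper coordinate subspace of that of \<open>I\<close>; the composite with
  \<open>f\<close> would have an open image there, although some coordinate vanishes on all of
  it.\<close>

lemma card_le_if_inj_coord_space:
  assumes fin: "finite I" "finite J"
    and U: "openin (top_of_set (coord_space I)) U" "U \<noteq> {}"
    and f: "continuous_on U f" "f ` U \<subseteq> coord_space J" "inj_on f U"
  shows "card I \<le> card J"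
proof (rule ccontr)
  assume "\<not> ?thesis"
  then obtain K where K: "K \<subseteq> I" "card K = card J"
    by (metis nat_le_linear obtain_subset_with_card_n)
  then have finK: "finite K" using fin(1) finite_subset by blast
  then obtain b where b: "bij_betw b K J" using K(2) fin(2) finite_same_card_bij by blast
  obtain g g' where g: "homeomorphism (coord_space J) (coord_space K) g g'"
    using homeomorphism_reindex[OF b] by blast
  have gfK: "(g \<circ> f) ` U \<subseteq> coord_space K" using f(2) homeomorphism_image1[OF g] by auto
  have "openin (top_of_set (coord_space I)) ((g \<circ> f) ` U)"
  proof (rule invariance_of_domain_coord_space[OF fin(1) fin(1) refl U(1)])
    show "continuous_on U (g \<circ> f)"
      by (intro continuous_on_compose f(1) continuous_on_subset[OF homeomorphism_cont1[OF g] f(2)])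
    have "coord_space K \<subseteq> coord_space I" using K(1) by (auto simp: coord_space_def)
    then show "(g \<circ> f) ` U \<subseteq> coord_space I" using gfK by blast
    have "inj_on g (coord_space J)" by (rule inj_on_inverseI[where g = g']) (rule homeomorphism_apply1[OF g])
    then show "inj_on (g \<circ> f) U" using f(2,3) by (meson comp_inj_on inj_on_subset)
  qed
  moreover obtain i where i: "i \<in> I" "i \<notin> K"
    using K \<open>\<not> card I \<le> card J\<close> by (metis order_refl subsetI subset_antisym)
  moreover obtain u where "u \<in> (g \<circ> f) ` U" using U(2) by blast
  ultimately obtain e where e: "e > 0" "\<And>s. \<bar>s - u i\<bar> < e \<Longrightarrow> u(i := s) \<in> (g \<circ> f) ` U"
    using openin_coord_space_update by metis
  have zero: "w i = 0" if "w \<in> (g \<circ> f) ` U" for w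
    using i subsetD[OF gfK that] by (simp add: coord_space_def)
  have "(u(i := u i + e / 2)) i = 0" by (rule zero, rule e(2)) (use e(1) in simp)
  then show False using zero[OF \<open>u \<in> (g \<circ> f) ` U\<close>] e(1) by simp
qed

text \<open>Handles the apex of a cone: where the scale \<open>s\<close> vanishes, \<open>b\<close>
  may be discontinuous as long as it stays bounded.\<close>

lemma continuous_on_mult_bounded:
  fixes s b :: "'c :: topological_space \<Rightarrow> real"
  assumes s: "continuous_on A s" and b: "continuous_on {x \<in> A. s x \<noteq> 0} b"
    and bound: "\<And>x. x \<in> A \<Longrightarrow> s x \<noteq> 0 \<Longrightarrow> \<bar>b x\<bar> \<le> 1"
  shows "continuous_on A (\<lambda>x. s x * b x)"
  unfolding continuous_on_def
proof
  fix x assume x: "x \<in> A"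
  show "((\<lambda>x. s x * b x) \<longlongrightarrow> s x * b x) (at x within A)"
  proof (cases "s x = 0")
    case True
    have "(s \<longlongrightarrow> 0) (at x within A)" using s x True by (metis continuous_on_def)
    moreover have "norm (s y * b y) \<le> norm (s y) * 1" if "y \<in> A" for y
      using bound[OF that] by (cases "s y = 0") (auto simp: abs_mult intro: mult_left_le)
    then have "\<forall>\<^sub>F y in at x within A. norm (s y * b y) \<le> norm (s y) * 1"
      by (auto simp: eventually_at_filter intro: always_eventually)
    ultimately have "((\<lambda>y. s y * b y) \<longlongrightarrow> 0) (at x within A)"
      by (rule tendsto_0_le)
    then show ?thesis using True by simp
  next
    case False
    obtain S where S: "open S" "S \<inter> A = s -` (- {0}) \<inter> A"
      using s by (metis continuous_on_open_invariant open_Compl closed_singleton)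
    have "x \<in> S" using S x False by auto
    then have "at x within A = at x within {x \<in> A. s x \<noteq> 0}"
      by (rule at_within_nhd[OF _ S(1)]) (use S in auto)
    moreover have "(b \<longlongrightarrow> b x) (at x within {x \<in> A. s x \<noteq> 0})"
      using b x False by (simp add: continuous_on_def)
    moreover have "(s \<longlongrightarrow> s x) (at x within A)" using s x by (simp add: continuous_on_def)
    ultimately show ?thesis by (simp add: tendsto_mult)
  qed
qed

section \<open>Ridges of simplicial spheres\<close>

lemma continuous_on_coord [continuous_intros]: "continuous_on S (\<lambda>x. x i :: real)"
  by (rule continuous_on_subset[OF continuous_on_product_coordinates]) simp

text \<open>The infinite cone over the geometric realization; unlike the realization itself it is made of
  full coordinate orthants.\<close>

definition face_cone :: "'a set set \<Rightarrow> ('a \<Rightarrow> real) set" where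
  "face_cone \<Delta> = {x. (\<forall>v. 0 \<le> x v) \<and> {v. x v \<noteq> 0} \<in> \<Delta>}"

text \<open>The homeomorphism with the sphere is extended radially: the coordinate sum
  \<open>s\<close> measures distance from the apex on one side, the Euclidean norm \<open>r\<close>
  on the other. The \<open>n\<close>-sphere spans dimension \<open>Suc n\<close>.\<close>

lemma sphere_cone_homeomorphism:
  assumes "simplicial_sphere V \<Delta>"
  obtains m :: nat and H H' where "homeomorphism (face_cone \<Delta>) (coord_space {..<m}) H H'"
proof -
  obtain n where sc: "simplicial_complex V \<Delta>"
    and "subtopology (powertop_real UNIV) (geom_realization \<Delta>) homeomorphic_space nsphere n"
    using assms unfolding simplicial_sphere_def by blast
  define X where "X = geom_realization \<Delta>"
  define S where "S = {x :: nat \<Rightarrow> real. (\<Sum>i\<le>n. x i ^ 2) = 1 \<and> (\<forall>i>n. x i = 0)}"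
  have "top_of_set X homeomorphic_space top_of_set S"
    using \<open>_ homeomorphic_space nsphere n\<close> unfolding nsphere X_def S_def
    by (simp only: euclidean_product_topology)
  then obtain h h' where h: "homeomorphism X S h h'"
    by (auto simp: homeomorphic_def)
  have finV: "finite V" and face: "\<And>\<sigma>. \<sigma> \<in> \<Delta> \<Longrightarrow> \<sigma> \<subseteq> V"
    and down: "\<And>\<sigma> \<tau>. \<sigma> \<in> \<Delta> \<Longrightarrow> \<tau> \<subseteq> \<sigma> \<Longrightarrow> \<tau> \<in> \<Delta>"
    using sc unfolding simplicial_complex_def by auto
  define s where "s x = (\<Sum>v\<in>V. x v)" for x :: "'a \<Rightarrow> real"
  define r where "r y = sqrt (\<Sum>i\<le>n. y i ^ 2)" for y :: "nat \<Rightarrow> real"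
  have X: "x \<in> X \<longleftrightarrow> x \<in> face_cone \<Delta> \<and> s x = 1" for x
  proof -
    have "sum x {v. x v \<noteq> 0} = s x" "finite {v. x v \<noteq> 0}" if "{v. x v \<noteq> 0} \<in> \<Delta>"
      unfolding s_def using finV face[OF that] finite_subset
      by (auto intro: sum.mono_neutral_left)
    then show ?thesis unfolding X_def geom_realization_def face_cone_def by auto
  qed
  have s_pos: "s x > 0" if x: "x \<in> face_cone \<Delta>" "x \<noteq> (\<lambda>_. 0)" for x
  proof -
    obtain v where v: "x v \<noteq> 0" using x(2) by auto
    then have "v \<in> V" using x(1) face unfolding face_cone_def by blast
    moreover have "\<forall>v. 0 \<le> x v" using x(1) by (simp add: face_cone_def)
    ultimately show ?thesis unfolding s_def using v finV
      by (metis less_eq_real_def sum_pos2)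
  qed
  have r_pos: "r y > 0" if y: "y \<in> coord_space {..<Suc n}" "y \<noteq> (\<lambda>_. 0)" for y
  proof -
    obtain i where i: "y i \<noteq> 0" using y(2) by auto
    then have "i \<in> {..<Suc n}" using y(1) unfolding coord_space_def by blast
    then have "i \<le> n" by simp
    then have "(\<Sum>i\<le>n. y i ^ 2) > 0" using i by (intro sum_pos2[of _ i]) auto
    then show ?thesis by (simp add: r_def)
  qed
  have scale_cone: "(\<lambda>v. c * x v) \<in> face_cone \<Delta>" if "x \<in> face_cone \<Delta>" "c \<ge> 0" for c x
  proof -
    have "{v. c * x v \<noteq> 0} \<subseteq> {v. x v \<noteq> 0}" by auto
    then show ?thesis using that down unfolding face_cone_def by auto
  qed
  have s_scale: "s (\<lambda>v. c * x v) = c * s x" for c x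
    by (simp add: s_def sum_distrib_left)
  have r_scale: "r (\<lambda>i. c * y i) = c * r y" if "c \<ge> 0" for c y
    using that by (simp add: r_def power_mult_distrib sum_distrib_left[symmetric] real_sqrt_mult)
  have scale_X: "(\<lambda>v. x v / s x) \<in> X" if "x \<in> face_cone \<Delta>" "x \<noteq> (\<lambda>_. 0)" for x
    using scale_cone[OF that(1), of "1 / s x"] s_scale[of "1 / s x" x] s_pos[OF that] by (simp add: X)
  have scale_S: "(\<lambda>i. y i / r y) \<in> S" if "y \<in> coord_space {..<Suc n}" "y \<noteq> (\<lambda>_. 0)" for y
  proof -
    have "r (\<lambda>i. y i / r y) = 1" using r_scale[of "1 / r y" y] r_pos[OF that] by simp
    then show ?thesis using that(1) unfolding S_def r_def coord_space_def by auto
  qed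
  have S_sub: "y \<in> coord_space {..<Suc n}" "r y = 1" if "y \<in> S" for y
    using that by (auto simp: S_def coord_space_def r_def)
  have S_bound: "\<bar>y i\<bar> \<le> 1" if "y \<in> S" for y i
  proof (cases "i \<le> n")
    case True
    then have "y i ^ 2 \<le> (\<Sum>i\<le>n. y i ^ 2)" by (intro member_le_sum) auto
    then show ?thesis using that by (simp add: S_def abs_square_le_1)
  qed (use that in \<open>simp add: S_def\<close>)
  have X_bound: "\<bar>x v\<bar> \<le> 1" if "x \<in> X" for x v
  proof (cases "x v = 0")
    case False
    have x: "\<forall>v. 0 \<le> x v" "{v. x v \<noteq> 0} \<in> \<Delta>" "s x = 1" using that by (auto simp: X face_cone_def)
    then have "x v \<le> s x" unfolding s_def using False face finV by (intro member_le_sum) auto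
    then show ?thesis using x by simp
  qed simp
  \<comment> \<open>At the apex the factor \<open>s x\<close> is 0, so the value of \<open>h\<close>
    at the quotient by zero has no influence; likewise for \<open>H'\<close>.\<close>
  define H where "H x = (\<lambda>i. s x * h (\<lambda>v. x v / s x) i)" for x
  define H' where "H' y = (\<lambda>v. r y * h' (\<lambda>i. y i / r y) v)" for y
  have hX: "h x \<in> S" "h' (h x) = x" if "x \<in> X" for x using h that by (auto simp: homeomorphism_def)
  have hS: "h' y \<in> X" "h (h' y) = y" if "y \<in> S" for y using h that by (auto simp: homeomorphism_def)
  have s0: "s (\<lambda>_. 0) = 0" and r0: "r (\<lambda>_. 0) = 0" by (auto simp: s_def r_def)
  have zero_cone: "(\<lambda>_. 0) \<in> face_cone \<Delta>" if "x \<in> face_cone \<Delta>" for x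
    using that down by (auto simp: face_cone_def)
  \<comment> \<open>The sphere is nonempty, hence so is the complex, and the apex belongs to the
    cone.\<close>
  obtain x0 where "x0 \<in> X"
  proof -
    have "(\<lambda>i. if i = 0 then 1 else 0) \<in> S"
      by (simp add: S_def if_distrib[of "\<lambda>x. x ^ 2"] cong: if_cong)
    then show ?thesis using hS that by blast
  qed
  then have zc: "(\<lambda>_. 0) \<in> face_cone \<Delta>" using zero_cone X by blast
  have "homeomorphism (face_cone \<Delta>) (coord_space {..<Suc n}) H H'"
  proof
    show "continuous_on (face_cone \<Delta>) H" unfolding H_def
    proof (rule continuous_on_coordinatewise_then_product, rule continuous_on_mult_bounded)
      show s_cont: "continuous_on (face_cone \<Delta>) s" unfolding s_def by (intro continuous_intros)
      fix i
      have nz: "x \<noteq> (\<lambda>_. 0)" if "s x \<noteq> 0" for x using that s0 by auto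
      show "continuous_on {x \<in> face_cone \<Delta>. s x \<noteq> 0} (\<lambda>x. h (\<lambda>v. x v / s x) i)"
      proof (rule continuous_on_product_then_coordinatewise, rule continuous_on_compose2[of X h])
        show "continuous_on X h" using h by (simp add: homeomorphism_def)
        show "continuous_on {x \<in> face_cone \<Delta>. s x \<noteq> 0} (\<lambda>x v. x v / s x)"
          by (intro continuous_on_coordinatewise_then_product continuous_on_divide continuous_on_coord
              continuous_on_subset[OF s_cont]) auto
      qed (use scale_X nz in auto)
      show "\<bar>h (\<lambda>v. x v / s x) i\<bar> \<le> 1" if "x \<in> face_cone \<Delta>" "s x \<noteq> 0" for x
        using S_bound hX scale_X nz that by blast
    qed
    show "continuous_on (coord_space {..<Suc n}) H'" unfolding H'_def
    proof (rule continuous_on_coordinatewise_then_product, rule continuous_on_mult_bounded)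
      show r_cont: "continuous_on (coord_space {..<Suc n}) r" unfolding r_def
        by (intro continuous_intros)
      fix v
      have nz: "y \<noteq> (\<lambda>_. 0)" if "r y \<noteq> 0" for y using that r0 by auto
      show "continuous_on {y \<in> coord_space {..<Suc n}. r y \<noteq> 0} (\<lambda>y. h' (\<lambda>i. y i / r y) v)"
      proof (rule continuous_on_product_then_coordinatewise, rule continuous_on_compose2[of S h'])
        show "continuous_on S h'" using h by (simp add: homeomorphism_def)
        show "continuous_on {y \<in> coord_space {..<Suc n}. r y \<noteq> 0} (\<lambda>y i. y i / r y)"
          by (intro continuous_on_coordinatewise_then_product continuous_on_divide continuous_on_coord
              continuous_on_subset[OF r_cont]) auto
      qed (use scale_S nz in auto)
      show "\<bar>h' (\<lambda>i. y i / r y) v\<bar> \<le> 1" if "y \<in> coord_space {..<Suc n}" "r y \<noteq> 0" for y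
        using X_bound hS scale_S nz that by blast
    qed
    show "H ` face_cone \<Delta> \<subseteq> coord_space {..<Suc n}"
    proof
      fix y assume "y \<in> H ` face_cone \<Delta>"
      then obtain x where x: "x \<in> face_cone \<Delta>" "y = H x" by blast
      show "y \<in> coord_space {..<Suc n}"
      proof (cases "x = (\<lambda>_. 0)")
        case True
        then show ?thesis using x s0 by (simp add: H_def coord_space_def)
      next
        case False
        then have "h (\<lambda>v. x v / s x) \<in> coord_space {..<Suc n}" using S_sub hX scale_X x by blast
        then show ?thesis using x by (simp add: H_def coord_space_def)
      qed
    qed
    show "H' ` coord_space {..<Suc n} \<subseteq> face_cone \<Delta>"
    proof
      fix x assume "x \<in> H' ` coord_space {..<Suc n}"
      then obtain y where y: "y \<in> coord_space {..<Suc n}" "x = H' y" by blast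
      show "x \<in> face_cone \<Delta>"
      proof (cases "y = (\<lambda>_. 0)")
        case True
        then show ?thesis using y r0 zc by (simp add: H'_def)
      next
        case False
        then have "h' (\<lambda>i. y i / r y) \<in> face_cone \<Delta>" using hS scale_S y X by blast
        then show ?thesis using y scale_cone r_pos[OF y(1) False] by (simp add: H'_def)
      qed
    qed
    show "H' (H x) = x" if x: "x \<in> face_cone \<Delta>" for x
    proof (cases "x = (\<lambda>_. 0)")
      case True
      then show ?thesis using s0 r0 by (simp add: H_def H'_def)
    next
      case False
      note p = s_pos[OF x False] and q = hX[OF scale_X[OF x False]]
      have "r (H x) = s x" unfolding H_def using r_scale[of "s x"] p S_sub(2)[OF q(1)] by simp
      then show ?thesis unfolding H'_def using p q by (simp add: H_def)
    qed
    show "H (H' y) = y" if y: "y \<in> coord_space {..<Suc n}" for y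
    proof (cases "y = (\<lambda>_. 0)")
      case True
      then show ?thesis using s0 r0 by (simp add: H_def H'_def)
    next
      case False
      note p = r_pos[OF y False] and q = hS[OF scale_S[OF y False]]
      have "s (H' y) = r y" unfolding H'_def using s_scale[of "r y"] p X q(1) by simp
      then show ?thesis unfolding H_def using p q by (simp add: H'_def)
    qed
  qed
  then show ?thesis using that by blast
qed

locale cone_chart =
  fixes C :: "('a \<Rightarrow> real) set" and m :: nat and H H'
  assumes chart: "homeomorphism C (coord_space {..<m}) H H'"
begin

text \<open>Invariance of domain with the cone as target, read through the global chart
  \<open>H\<close>.\<close>

lemma openin_image_of_coord_space:
  assumes "finite I" "card I = m" "openin (top_of_set (coord_space I)) U"
    and g: "continuous_on U g" "g ` U \<subseteq> C" "inj_on g U"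
  shows "openin (top_of_set C) (g ` U)"
proof -
  have HC: "H ` C = coord_space {..<m}" "continuous_on C H" and inv: "\<And>x. x \<in> C \<Longrightarrow> H' (H x) = x"
    using chart by (auto simp: homeomorphism_def)
  have "openin (top_of_set (coord_space {..<m})) ((H \<circ> g) ` U)"
  proof (rule invariance_of_domain_coord_space[OF assms(1) _ _ assms(3)])
    show "continuous_on U (H \<circ> g)"
      by (intro continuous_on_compose g(1) continuous_on_subset[OF HC(2) g(2)])
    show "(H \<circ> g) ` U \<subseteq> coord_space {..<m}" using HC(1) g(2) by auto
    have "inj_on H C" by (rule inj_on_inverseI) (rule inv)
    then show "inj_on (H \<circ> g) U" using g(2,3) by (meson comp_inj_on inj_on_subset)
  qed (use assms(2) in auto)
  then have "openin (top_of_set C) (H' ` (H \<circ> g) ` U)"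
    by (rule homeomorphism_imp_open_map[OF homeomorphism_symD[OF chart]])
  moreover have "H' ` (H \<circ> g) ` U = g ` U" using inv g(2) by (force simp: image_image image_iff)
  ultimately show ?thesis by simp
qed

text \<open>The opposite direction: an open piece of the cone that fits into a coordinate space is a
  Euclidean open set of dimension \<open>m\<close> embedded there.\<close>

lemma openin_in_coord_space:
  assumes W: "openin (top_of_set C) W" "W \<noteq> {}" "W \<subseteq> coord_space I" and "finite I"
  shows "m \<le> card I" and "card I = m \<Longrightarrow> openin (top_of_set (coord_space I)) W"
proof -
  have H': "continuous_on (coord_space {..<m}) H'" and inv: "\<And>x. x \<in> C \<Longrightarrow> H' (H x) = x"
    and inv': "\<And>y. y \<in> coord_space {..<m} \<Longrightarrow> H (H' y) = y" using chart by (auto simp: homeomorphism_def)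
  have op: "openin (top_of_set (coord_space {..<m})) (H ` W)"
    by (rule homeomorphism_imp_open_map[OF chart W(1)])
  have eq: "H' ` H ` W = W" using inv openin_imp_subset[OF W(1)] by (force simp: image_image image_iff)
  have cont: "continuous_on (H ` W) H'" using H' openin_imp_subset[OF op] continuous_on_subset by blast
  have inj: "inj_on H' (H ` W)"
    by (rule inj_on_inverseI[where g = H]) (use inv' openin_imp_subset[OF op] in blast)
  show "m \<le> card I"
    using card_le_if_inj_coord_space[OF _ assms(4) op _ cont _ inj] W eq by simp
  show "openin (top_of_set (coord_space I)) W" if "card I = m"
    using invariance_of_domain_coord_space[OF _ assms(4) _ op cont _ inj] W eq that by simp
qed

end

lemma openin_positive_coords:
  assumes "finite R"
  shows "openin (top_of_set S) {x \<in> S. \<forall>u\<in>R. 0 < (x u :: real)}"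
proof -
  have "open (\<Inter>u\<in>R. {x. 0 < (x u :: real)})"
    using assms by (intro open_INT ballI open_Collect_less continuous_intros) auto
  moreover have "{x \<in> S. \<forall>u\<in>R. 0 < x u} = S \<inter> (\<Inter>u\<in>R. {x. 0 < x u})" by auto
  ultimately show ?thesis by (simp add: openin_open_Int)
qed

lemma ex_facet_superset:
  assumes "simplicial_complex V \<Delta>" "\<sigma> \<in> \<Delta>"
  obtains T where "T \<in> facets \<Delta>" "\<sigma> \<subseteq> T"
proof -
  have "\<Delta> \<subseteq> Pow V" "finite V" using assms(1) by (auto simp: simplicial_complex_def)
  then have "finite \<Delta>" using finite_subset by blast
  then obtain T where "T \<in> \<Delta>" "\<sigma> \<subseteq> T" "\<forall>\<tau>\<in>\<Delta>. T \<subseteq> \<tau> \<longrightarrow> \<tau> = T"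
    using finite_has_maximal2[OF _ assms(2)] by metis
  then show ?thesis using that by (auto simp: facets_def)
qed

text \<open>Near a point in the relative interior of the cone over a ridge, the cone is a book with
  one page for each facet through the ridge. A single page, or three and more, is incompatible with
  the chart.\<close>

lemma sphere_facet_across_ridge:
  assumes sphere: "simplicial_sphere V \<Delta>" and T: "T \<in> facets \<Delta>" and v: "v \<in> T"
  shows "\<exists>!U. U \<in> facets \<Delta> \<and> U \<noteq> T \<and> T - {v} \<subseteq> U"
proof -
  have sc: "simplicial_complex V \<Delta>" using sphere by (simp add: simplicial_sphere_def)
  then have down: "\<And>\<sigma> \<tau>. \<sigma> \<in> \<Delta> \<Longrightarrow> \<tau> \<subseteq> \<sigma> \<Longrightarrow> \<tau> \<in> \<Delta>" and fin: "\<And>\<sigma>. \<sigma> \<in> \<Delta> \<Longrightarrow> finite \<sigma>"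
    by (auto simp: simplicial_complex_def intro: finite_subset)
  obtain m :: nat and H H' where chart: "homeomorphism (face_cone \<Delta>) (coord_space {..<m}) H H'"
    using sphere_cone_homeomorphism[OF sphere] .
  interpret cone_chart "face_cone \<Delta>" m H H' by (unfold_locales) (rule chart)
  have facetD: "U \<in> \<Delta>" "finite U" if "U \<in> facets \<Delta>" for U
    using that fin by (auto simp: facets_def)
  have cone_in: "x \<in> face_cone \<Delta>" if "\<sigma> \<in> \<Delta>" "\<And>u. 0 \<le> x u" "\<And>u. u \<notin> \<sigma> \<Longrightarrow> x u = 0" for x \<sigma>
  proof -
    have "{u. x u \<noteq> 0} \<subseteq> \<sigma>" using that(3) by blast
    then show ?thesis using that down by (auto simp: face_cone_def)
  qed
  \<comment> \<open>The open star of \<open>R\<close> in the cone: the supports of its points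
    contain \<open>R\<close>.\<close>
  define pos where "pos R = {x \<in> face_cone \<Delta>. \<forall>u\<in>R. 0 < x u}" for R
  have pos_open: "openin (top_of_set (face_cone \<Delta>)) (pos R)" if "finite R" for R
    unfolding pos_def by (rule openin_positive_coords[OF that])
  have indic: "(\<lambda>u. if u \<in> R then 1 else 0) \<in> pos R" if "R \<in> \<Delta>" for R
    unfolding pos_def using cone_in[OF that] by auto
  \<comment> \<open>The open star of a facet is an open orthant, open both in the cone and in the
    coordinate space of the facet, so comparing dimensions both ways gives \<open>m\<close>.\<close>
  have card_facet: "card U = m" if U: "U \<in> facets \<Delta>" for U
  proof (rule antisym)
    have sub: "pos U \<subseteq> coord_space U"
    proof
      fix x assume x: "x \<in> pos U"
      then have "{u. x u \<noteq> 0} \<in> \<Delta>" "U \<subseteq> {u. x u \<noteq> 0}" by (force simp: pos_def face_cone_def)+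
      then have "{u. x u \<noteq> 0} = U" using U by (auto simp: facets_def)
      then show "x \<in> coord_space U" by (auto simp: coord_space_def)
    qed
    show "m \<le> card U"
      using openin_in_coord_space(1)[OF pos_open _ sub] indic facetD[OF U] by blast
    have "{x \<in> coord_space U. \<forall>u\<in>U. 0 < x u} \<subseteq> face_cone \<Delta>"
    proof
      fix x assume "x \<in> {x \<in> coord_space U. \<forall>u\<in>U. 0 < x u}"
      then have "\<And>u. u \<notin> U \<Longrightarrow> x u = 0" "\<And>u. 0 \<le> x u"
        by (auto simp: coord_space_def) (metis less_eq_real_def)
      then show "x \<in> face_cone \<Delta>" using cone_in[OF facetD(1)[OF U]] by blast
    qed
    then have "pos U = {x \<in> coord_space U. \<forall>u\<in>U. 0 < x u}" using sub by (auto simp: pos_def)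
    then have "openin (top_of_set (coord_space U)) (pos U)"
      using openin_positive_coords[OF facetD(2)[OF U], of "coord_space U"] by simp
    moreover have "continuous_on (pos U) H" "H ` pos U \<subseteq> coord_space {..<m}" "inj_on H (pos U)"
      using chart unfolding homeomorphism_def pos_def
      by (auto intro: continuous_on_subset inj_on_inverseI[where g = H'])
    ultimately show "card U \<le> m"
      using card_le_if_inj_coord_space[of U "{..<m}" "pos U" H] indic facetD[OF U] by auto
  qed
  define R where "R = T - {v}"
  have R: "R \<in> \<Delta>" "finite R" "v \<notin> R" "T = insert v R"
    using facetD[OF T] down v by (auto simp: R_def)
  \<comment> \<open>A point whose support is exactly the ridge, where all pages meet.\<close>
  define e where "e = (\<lambda>u. if u \<in> R then 1 else (0::real))"
  have other: "\<exists>u. u \<notin> R \<and> u \<noteq> v \<and> U = insert u R" if U: "U \<in> facets \<Delta>" "U \<noteq> T" "R \<subseteq> U" for U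
  proof -
    have "card (U - R) = 1"
      using card_facet[OF U(1)] card_facet[OF T] R card_Diff_subset[OF R(2) U(3)] by simp
    then obtain u where "U - R = {u}" by (auto simp: card_1_singleton_iff)
    then show ?thesis using U R by blast
  qed
  have "\<exists>U. U \<in> facets \<Delta> \<and> U \<noteq> T \<and> R \<subseteq> U"
  proof (rule ccontr)
    \<comment> \<open>With \<open>T\<close> as the only page, the open star of \<open>R\<close>
      would be open in the coordinate space of \<open>T\<close>, yet making coordinate
      \<open>v\<close> negative leaves it.\<close>
    assume none: "\<not> ?thesis"
    have sub: "pos R \<subseteq> coord_space T"
    proof
      fix x assume x: "x \<in> pos R"
      then have *: "{u. x u \<noteq> 0} \<in> \<Delta>" "R \<subseteq> {u. x u \<noteq> 0}" by (force simp: pos_def face_cone_def)+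
      obtain U where "U \<in> facets \<Delta>" "{u. x u \<noteq> 0} \<subseteq> U" using ex_facet_superset[OF sc *(1)] .
      then have "{u. x u \<noteq> 0} \<subseteq> T" using none * by blast
      then show "x \<in> coord_space T" by (auto simp: coord_space_def)
    qed
    have eR: "e \<in> pos R" unfolding e_def using indic[OF R(1)] .
    have "openin (top_of_set (coord_space T)) (pos R)"
      using openin_in_coord_space(2)[OF pos_open[OF R(2)] _ sub] eR facetD[OF T] card_facet[OF T] by blast
    then obtain \<epsilon> where \<epsilon>: "\<epsilon> > 0" "\<And>s. \<bar>s - e v\<bar> < \<epsilon> \<Longrightarrow> e(v := s) \<in> pos R"
      using openin_coord_space_update[OF _ eR v] by blast
    have "e(v := - \<epsilon> / 2) \<in> pos R" by (rule \<epsilon>(2)) (use \<epsilon>(1) R(3) in \<open>simp add: e_def\<close>)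
    then have "0 \<le> (e(v := - \<epsilon> / 2)) v" by (simp add: pos_def face_cone_def del: fun_upd_apply)
    then show False using \<epsilon>(1) by simp
  qed
  moreover have "U = U'" if U: "U \<in> facets \<Delta>" "U \<noteq> T" "R \<subseteq> U" and U': "U' \<in> facets \<Delta>" "U' \<noteq> T" "R \<subseteq> U'"
    for U U'
  proof (rule ccontr)
    assume "U \<noteq> U'"
    obtain u where u: "u \<notin> R" "u \<noteq> v" "U = insert u R" using other[OF U] by blast
    obtain u' where u': "u' \<notin> R" "u' \<noteq> v" "U' = insert u' R" using other[OF U'] by blast
    have "u \<noteq> u'" using u u' \<open>U \<noteq> U'\<close> by blast
    define P where "P = {x \<in> coord_space T. \<forall>u\<in>R. 0 < x u}"
    \<comment> \<open>Folds a flat space onto the pages \<open>T\<close> and \<open>U\<close>: a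
      negative coordinate \<open>v\<close> becomes a positive coordinate \<open>u\<close>. The image
      is open in the cone, but a small move from \<open>e\<close> onto the third page
      \<open>U'\<close> leaves it.\<close>
    define g where "g x = (\<lambda>w. if w \<in> R then x w else if w = v then max (x v) 0
      else if w = u then max (- x v) 0 else (0::real))" for x
    have "openin (top_of_set (face_cone \<Delta>)) (g ` P)"
    proof (rule openin_image_of_coord_space)
      show "finite T" "card T = m" using T facetD card_facet by auto
      show "openin (top_of_set (coord_space T)) P" unfolding P_def by (rule openin_positive_coords[OF R(2)])
      show "continuous_on P g"
      proof (rule continuous_on_coordinatewise_then_product)
        fix w
        show "continuous_on P (\<lambda>x. g x w)" unfolding g_def
          by (cases "w \<in> R"; cases "w = v"; cases "w = u") (auto intro!: continuous_intros)
      qed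
      show "g ` P \<subseteq> face_cone \<Delta>"
      proof
        fix y assume "y \<in> g ` P"
        then obtain x where x: "x \<in> P" "y = g x" by blast
        have nonneg: "0 \<le> y w" for w using x by (auto simp: g_def P_def intro: less_imp_le)
        show "y \<in> face_cone \<Delta>"
        proof (cases "0 \<le> x v")
          case True
          then show ?thesis
            by (intro cone_in[OF facetD(1)[OF T] nonneg]) (use x R in \<open>auto simp: g_def\<close>)
        next
          case False
          then show ?thesis
            by (intro cone_in[OF facetD(1)[OF U(1)] nonneg]) (use x R u in \<open>auto simp: g_def\<close>)
        qed
      qed
      show "inj_on g P"
      proof (rule inj_onI, rule ext)
        fix x y w assume xy: "x \<in> P" "y \<in> P" and eq: "g x = g y"
        have "max (x v) 0 = max (y v) 0" "max (- x v) 0 = max (- y v) 0"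
          using fun_cong[OF eq, of v] fun_cong[OF eq, of u] R(3) u by (simp_all add: g_def)
        then have "x v = y v" by linarith
        moreover have "x w = y w" if "w \<in> R" using fun_cong[OF eq, of w] that by (simp add: g_def)
        moreover have "x w = 0 \<and> y w = 0" if "w \<notin> T" using xy that by (simp add: P_def coord_space_def)
        ultimately show "x w = y w" using R(4) by (cases "w \<in> T") auto
      qed
    qed
    then obtain Q where Q: "open Q" "g ` P = face_cone \<Delta> \<inter> Q" by (auto simp: openin_open)
    have "e \<in> P" using R by (auto simp: P_def e_def coord_space_def)
    moreover have "g e = e" using R(3) u(1) by (auto simp: g_def e_def)
    ultimately have eQ: "e \<in> Q" using Q(2) by (metis IntD2 imageI)
    have "continuous_on UNIV (\<lambda>s. e(u' := s))"
    proof (rule continuous_on_coordinatewise_then_product)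
      fix j show "continuous_on UNIV (\<lambda>s. (e(u' := s)) j)" by (cases "j = u'") auto
    qed
    then have "open ((\<lambda>s. e(u' := s)) -` Q)" using Q(1) by (simp add: open_vimage)
    moreover have "e(u' := 0) = e" using u'(1) by (auto simp: e_def)
    then have "0 \<in> (\<lambda>s. e(u' := s)) -` Q" using eQ by simp
    ultimately obtain \<epsilon> where \<epsilon>: "\<epsilon> > 0" "\<And>s. dist s 0 < \<epsilon> \<Longrightarrow> s \<in> (\<lambda>s. e(u' := s)) -` Q"
      by (metis open_dist)
    have "e(u' := \<epsilon> / 2) \<in> Q" using \<epsilon>(2)[of "\<epsilon> / 2"] \<epsilon>(1) by simp
    moreover have "e(u' := \<epsilon> / 2) \<in> face_cone \<Delta>"
      by (rule cone_in[OF facetD(1)[OF U'(1)]]) (use u' \<epsilon>(1) in \<open>auto simp: e_def\<close>)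
    ultimately have "e(u' := \<epsilon> / 2) \<in> g ` P" using Q(2) by blast
    then obtain x where "e(u' := \<epsilon> / 2) = g x" by blast
    then have "g x u' = \<epsilon> / 2" by (metis fun_upd_same)
    then show False using u' \<open>u \<noteq> u'\<close> \<epsilon>(1) by (simp add: g_def)
  qed
  ultimately show ?thesis unfolding R_def by blast
qed

section \<open>Facet systems\<close>

text \<open>The facets are indexed by an abstract set of nodes, so that two complexes with isomorphic
  facet-ridge graphs become two facet systems on the same nodes with the same adjacency.\<close>

locale facet_system =
  fixes N :: "'n set" and F :: "'n \<Rightarrow> 'a set" and d :: nat
  assumes finite_N: "finite N"
    and finite_F: "y \<in> N \<Longrightarrow> finite (F y)"
    and card_F: "y \<in> N \<Longrightarrow> card (F y) = d"
    and inj_F: "inj_on F N"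
    and ex1_across: "y \<in> N \<Longrightarrow> v \<in> F y \<Longrightarrow> \<exists>!w. w \<in> N \<and> w \<noteq> y \<and> F y - {v} \<subseteq> F w"
begin

definition adj :: "'n \<Rightarrow> 'n \<Rightarrow> bool" where
  "adj y w \<longleftrightarrow> y \<in> N \<and> w \<in> N \<and> y \<noteq> w \<and> card (F y \<inter> F w) + 1 = d"

definition across :: "'n \<Rightarrow> 'a \<Rightarrow> 'n" where
  "across y v = (THE w. w \<in> N \<and> w \<noteq> y \<and> F y - {v} \<subseteq> F w)"

definition star :: "'a set \<Rightarrow> 'n set" where
  "star \<sigma> = {y \<in> N. \<sigma> \<subseteq> F y}"

lemma across:
  assumes "y \<in> N" "v \<in> F y"
  shows "across y v \<in> N" "across y v \<noteq> y" "F y - {v} \<subseteq> F (across y v)"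
  using theI'[OF ex1_across[OF assms]] unfolding across_def by blast+

lemma across_eqI:
  assumes "y \<in> N" "v \<in> F y" "w \<in> N" "w \<noteq> y" "F y - {v} \<subseteq> F w"
  shows "across y v = w"
  using ex1_across[OF assms(1,2)] across[OF assms(1,2)] assms by blast

lemma facet_subset_imp_eq:
  assumes "y \<in> N" "w \<in> N" "F y \<subseteq> F w"
  shows "y = w"
  by (metis assms card_F card_subset_eq finite_F inj_F inj_onD)

lemma Int_across:
  assumes "y \<in> N" "v \<in> F y"
  shows "F y \<inter> F (across y v) = F y - {v}"
proof -
  have "v \<notin> F (across y v)"
  proof
    assume "v \<in> F (across y v)"
    then have "F y \<subseteq> F (across y v)" using across(3)[OF assms] by auto
    then show False using facet_subset_imp_eq across(1,2)[OF assms] assms(1) by metis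
  qed
  then show ?thesis using across(3)[OF assms] by auto
qed

lemma adj_sym: "adj y w \<Longrightarrow> adj w y"
  by (auto simp: adj_def Int_commute)

lemma adj_in_N: "adj y w \<Longrightarrow> y \<in> N \<and> w \<in> N"
  by (simp add: adj_def)

lemma adj_across:
  assumes "y \<in> N" "v \<in> F y"
  shows "adj y (across y v)"
proof -
  have "card (F y - {v}) + 1 = d"
    using card_F[OF assms(1)] finite_F[OF assms(1)] assms(2)
    by (metis Suc_eq_plus1 card_Suc_Diff1)
  then show ?thesis
    using assms across[OF assms] Int_across[OF assms] by (simp add: adj_def)
qed

lemma adj_imp_across:
  assumes "adj y w"
  obtains v where "v \<in> F y" "w = across y v"
proof -
  have y: "y \<in> N" and w: "w \<in> N" and "y \<noteq> w" and c: "card (F y \<inter> F w) + 1 = d"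
    using assms by (auto simp: adj_def)
  have "card (F y - F w) = 1"
    using card_Diff_subset_Int[of "F y" "F w"] finite_F[OF y] card_F[OF y] c by simp
  then obtain v where v: "F y - F w = {v}" by (auto simp: card_1_singleton_iff)
  then have "across y v = w"
    by (intro across_eqI) (use y w \<open>y \<noteq> w\<close> v in auto)
  then show ?thesis using that v by blast
qed

text \<open>The ridge shared with a neighbour recovers the dropped vertex. This is how the graph
  sees the vertices of a facet.\<close>

lemma bij_betw_across:
  assumes "y \<in> N"
  shows "bij_betw (across y) (F y) {w. adj y w}"
proof -
  have "inj_on (across y) (F y)"
  proof (rule inj_onI)
    fix u v assume "u \<in> F y" "v \<in> F y" "across y u = across y v"
    then have "F y - {u} = F y - {v}" using Int_across assms by metis
    then show "u = v" using \<open>u \<in> F y\<close> \<open>v \<in> F y\<close> by blast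
  qed
  then show ?thesis
    unfolding bij_betw_def using adj_across[OF assms] by (auto elim: adj_imp_across)
qed

lemma ridge_in_two:
  assumes "adj y w" "z \<in> N" "F y \<inter> F w \<subseteq> F z"
  shows "z = y \<or> z = w"
proof -
  have y: "y \<in> N" using assms by (simp add: adj_def)
  obtain v where v: "v \<in> F y" "w = across y v" using assms(1) by (rule adj_imp_across)
  then have "F y - {v} \<subseteq> F z" using Int_across[OF y] assms(3) by simp
  then show ?thesis using across_eqI[OF y v(1) assms(2)] v by blast
qed

lemma star_two_neighbours:
  assumes "y \<in> star \<tau>" "card \<tau> + 2 = d"
  obtains p q where "p \<noteq> q" "p \<notin> \<tau>" "q \<notin> \<tau>" "F y = insert p (insert q \<tau>)"
    "{w \<in> star \<tau>. adj y w} = {across y p, across y q}" "across y p \<noteq> across y q"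
proof -
  have y: "y \<in> N" "\<tau> \<subseteq> F y" using assms by (auto simp: star_def)
  have "card (F y - \<tau>) = 2"
    using card_Diff_subset[of \<tau> "F y"] y finite_F card_F assms(2)
    by (metis add_diff_cancel_left' finite_subset)
  then obtain p q where pq: "F y - \<tau> = {p, q}" "p \<noteq> q" by (auto simp: card_2_iff)
  have in_star: "across y v \<in> star \<tau> \<longleftrightarrow> v \<in> {p, q}" if "v \<in> F y" for v
    using Int_across[OF y(1) that] across[OF y(1) that] y pq that unfolding star_def by blast
  have "{w \<in> star \<tau>. adj y w} = {across y p, across y q}"
  proof (intro subset_antisym subsetI)
    fix w assume "w \<in> {w \<in> star \<tau>. adj y w}"
    then show "w \<in> {across y p, across y q}"
      using in_star by (auto elim!: adj_imp_across)
  next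
    fix w assume "w \<in> {across y p, across y q}"
    then show "w \<in> {w \<in> star \<tau>. adj y w}"
      using in_star adj_across[OF y(1)] pq by blast
  qed
  moreover have "across y p \<noteq> across y q"
    using bij_betw_across[OF y(1)] pq by (auto simp: bij_betw_def inj_on_def)
  ultimately show ?thesis using that pq y by blast
qed

lemma star_neighbour_ridge:
  assumes "y \<in> star \<tau>" "w \<in> star \<tau>" "adj y w" "card \<tau> + 2 = d"
  obtains x where "x \<notin> \<tau>" "F y \<inter> F w = insert x \<tau>"
proof -
  obtain p q where pq: "p \<noteq> q" "p \<notin> \<tau>" "q \<notin> \<tau>" "F y = insert p (insert q \<tau>)"
    "{w \<in> star \<tau>. adj y w} = {across y p, across y q}"
    using star_two_neighbours[OF assms(1,4)] by metis
  have y: "y \<in> N" using assms(1) by (simp add: star_def)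
  have "w = across y p \<or> w = across y q" using assms pq(5) by blast
  then show ?thesis
  proof
    assume "w = across y p"
    then have "F y \<inter> F w = insert q \<tau>" using Int_across[OF y, of p] pq by auto
    then show ?thesis using that pq by blast
  next
    assume "w = across y q"
    then have "F y \<inter> F w = insert p \<tau>" using Int_across[OF y, of q] pq by auto
    then show ?thesis using that pq by blast
  qed
qed

lemma finite_star [simp]: "finite (star \<sigma>)"
  by (simp add: star_def finite_N)

section \<open>Parity of cuts in the star of a codimension two face\<close>

lemma even_card_adj_pairs:
  assumes "finite U"
  shows "even (card {(v, w). v \<in> U \<and> w \<in> U \<and> adj v w})"
  using assms
proof (induction U rule: finite_induct)
  case (insert u U)
  let ?A = "{(v, w). v \<in> U \<and> w \<in> U \<and> adj v w}" and ?n = "{w \<in> U. adj u w}"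
  have eq: "{(v, w). v \<in> insert u U \<and> w \<in> insert u U \<and> adj v w} =
      ?A \<union> (Pair u ` ?n \<union> (\<lambda>w. (w, u)) ` ?n)"
    by (auto simp: adj_def Int_commute)
  have "finite ?A" using insert by (auto intro: finite_subset[of _ "U \<times> U"])
  moreover have "card (Pair u ` ?n \<union> (\<lambda>w. (w, u)) ` ?n) = card ?n + card ?n"
    using insert by (subst card_Un_disjoint) (auto simp: card_image inj_on_def)
  moreover have "?A \<inter> (Pair u ` ?n \<union> (\<lambda>w. (w, u)) ` ?n) = {}"
    using insert by auto
  ultimately have "card {(v, w). v \<in> insert u U \<and> w \<in> insert u U \<and> adj v w} =
      card ?A + (card ?n + card ?n)"
    unfolding eq using insert by (subst card_Un_disjoint) auto
  then show ?case using insert.IH by simp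
qed simp

text \<open>The degrees in \<open>U\<close> add up to twice its size, and edges inside
  \<open>U\<close> are counted twice. This parity replaces an explicit cyclic order on the
  star.\<close>

lemma even_star_cut:
  assumes "U \<subseteq> star \<tau>" "card \<tau> + 2 = d"
  shows "even (card {(v, w). v \<in> U \<and> w \<in> star \<tau> - U \<and> adj v w})"
proof -
  have finU: "finite U" using assms(1) finite_subset finite_star by metis
  let ?in = "{(v, w). v \<in> U \<and> w \<in> U \<and> adj v w}"
  let ?out = "{(v, w). v \<in> U \<and> w \<in> star \<tau> - U \<and> adj v w}"
  have "card {w \<in> star \<tau>. adj v w} = 2" if "v \<in> U" for v
    using star_two_neighbours[of v \<tau>] assms that by (metis card_2_iff subsetD)
  then have "card (SIGMA v:U. {w \<in> star \<tau>. adj v w}) = 2 * card U"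
    using finU by (subst card_SigmaI) auto
  moreover have "(SIGMA v:U. {w \<in> star \<tau>. adj v w}) = ?in \<union> ?out"
    using assms(1) by auto
  moreover have "card (?in \<union> ?out) = card ?in + card ?out"
    using finU
    by (intro card_Un_disjoint)
      (auto intro: finite_subset[of _ "U \<times> U"] finite_subset[of _ "U \<times> star \<tau>"])
  ultimately have "card ?in + card ?out = 2 * card U" by simp
  then have "even (card ?in + card ?out)" by simp
  then show ?thesis using even_card_adj_pairs[OF finU] even_add by blast
qed

text \<open>Walking around a cycle from one neighbour of \<open>t\<close> to the other without
  passing \<open>t\<close>. If \<open>g\<close> differed at the ends, the set where it holds would
  have exactly one outgoing edge, namely into \<open>t\<close>.\<close>

lemma star_cut_constant:
  assumes "card \<tau> + 2 = d" "t \<in> star \<tau>"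
    and y: "y \<in> star \<tau>" "adj t y" "y' \<in> star \<tau>" "adj t y'" "y \<noteq> y'"
    and const: "\<And>v w. v \<in> star \<tau> - {t} \<Longrightarrow> w \<in> star \<tau> - {t} \<Longrightarrow> adj v w \<Longrightarrow> g v = g w"
  shows "(g y :: bool) = g y'"
proof (rule ccontr)
  assume neq: "g y \<noteq> g y'"
  obtain p q where pq: "{w \<in> star \<tau>. adj t w} = {across t p, across t q}"
    using star_two_neighbours[OF assms(2,1)] by metis
  moreover have "{y, y'} \<subseteq> {w \<in> star \<tau>. adj t w}" using y by blast
  ultimately have nbs: "{w \<in> star \<tau>. adj t w} = {y, y'}" using y(5) by auto
  let ?U = "{v \<in> star \<tau> - {t}. g v}"
  have "(v \<in> ?U \<and> w \<in> star \<tau> - ?U \<and> adj v w) \<longleftrightarrow> (w = t \<and> v \<in> {y, y'} \<and> g v)" for v w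
  proof
    assume *: "v \<in> ?U \<and> w \<in> star \<tau> - ?U \<and> adj v w"
    then have "w = t" using const[of v w] by auto
    moreover from this have "v \<in> {y, y'}" using nbs * adj_sym by blast
    ultimately show "w = t \<and> v \<in> {y, y'} \<and> g v" using * by blast
  next
    assume *: "w = t \<and> v \<in> {y, y'} \<and> g v"
    then have "v \<in> star \<tau>" "adj t v" using nbs by auto
    then show "v \<in> ?U \<and> w \<in> star \<tau> - ?U \<and> adj v w"
      using * assms(2) adj_sym[of t v] by (auto simp: adj_def)
  qed
  then have "{(v, w). v \<in> ?U \<and> w \<in> star \<tau> - ?U \<and> adj v w} = {(v, t) |v. v \<in> {y, y'} \<and> g v}"
    by auto
  moreover have "{(v, t) |v. v \<in> {y, y'} \<and> g v} = {(if g y then y else y', t)}"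
    using neq by auto
  ultimately have "card {(v, w). v \<in> ?U \<and> w \<in> star \<tau> - ?U \<and> adj v w} = 1" by simp
  moreover have "even (card {(v, w). v \<in> ?U \<and> w \<in> star \<tau> - ?U \<and> adj v w})"
    by (rule even_star_cut) (use assms(1) in auto)
  ultimately show False by simp
qed

text \<open>If \<open>g\<close> held at no neighbour of \<open>t\<close>, the edge from
  \<open>z\<close> to \<open>w\<close> would be the only one leaving the set where \<open>g\<close>
  holds, an odd cut.\<close>

lemma star_cut_escape:
  assumes "card \<tau> + 2 = d" "t \<in> star \<tau>"
    and zw: "z \<in> star \<tau> - {t}" "w \<in> star \<tau> - {t}" "adj z w" "g z" "\<not> g w"
    and const: "\<And>u v. u \<in> star \<tau> - {t} \<Longrightarrow> v \<in> star \<tau> - {t} \<Longrightarrow> adj u v \<Longrightarrow>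
                  {u, v} \<noteq> {z, w} \<Longrightarrow> g u = g v"
  shows "\<exists>y. y \<in> star \<tau> \<and> adj t y \<and> (g y :: bool)"
proof (rule ccontr)
  assume "\<not> ?thesis"
  then have none: "\<not> g y" if "y \<in> star \<tau>" "adj t y" for y using that by blast
  let ?U = "{v \<in> star \<tau> - {t}. g v}"
  have "(u \<in> ?U \<and> v \<in> star \<tau> - ?U \<and> adj u v) \<longleftrightarrow> (u = z \<and> v = w)" for u v
  proof
    assume *: "u \<in> ?U \<and> v \<in> star \<tau> - ?U \<and> adj u v"
    have "v \<noteq> t" using none * adj_sym by blast
    then have "\<not> g v" using * by blast
    then have "{u, v} = {z, w}" using const[of u v] * \<open>v \<noteq> t\<close> by blast
    then show "u = z \<and> v = w" using * zw by (auto simp: doubleton_eq_iff)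
  next
    assume "u = z \<and> v = w"
    then show "u \<in> ?U \<and> v \<in> star \<tau> - ?U \<and> adj u v" using zw by auto
  qed
  then have "{(u, v). u \<in> ?U \<and> v \<in> star \<tau> - ?U \<and> adj u v} = {(z, w)}" by auto
  moreover have "even (card {(u, v). u \<in> ?U \<and> v \<in> star \<tau> - ?U \<and> adj u v})"
    by (rule even_star_cut) (use assms(1) in auto)
  ultimately show False by simp
qed

end

text \<open>Descending along \<open>R\<close> inside \<open>S\<close> always ends at the least
  element of \<open>S\<close>. Applied to vertex stars, it turns agreement on edges into agreement
  everywhere.\<close>

lemma const_by_descent:
  fixes idx :: "'n \<Rightarrow> nat"
  assumes inj: "inj_on idx S"
    and desc: "\<And>y z. y \<in> S \<Longrightarrow> z \<in> S \<Longrightarrow> idx z < idx y \<Longrightarrow> \<exists>w\<in>S. R y w \<and> idx w < idx y"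
    and const: "\<And>y w. y \<in> S \<Longrightarrow> w \<in> S \<Longrightarrow> R y w \<Longrightarrow> g y = g w"
    and "y \<in> S" "z \<in> S"
  shows "g y = g z"
proof -
  obtain m where m: "m \<in> S" "\<And>u. u \<in> S \<Longrightarrow> idx m \<le> idx u"
    using ex_has_least_nat[of "\<lambda>u. u \<in> S" y idx] assms(4) by blast
  have "u \<in> S \<Longrightarrow> g u = g m" for u
  proof (induction "idx u" arbitrary: u rule: less_induct)
    case less
    show ?case
    proof (cases "u = m")
      case False
      then have "idx m < idx u" using m less.prems inj by (metis inj_onD le_neq_implies_less)
      then obtain w where "w \<in> S" "R u w" "idx w < idx u" using desc less.prems m(1) by blast
      then show ?thesis using less const by metis
    qed simp
  qed
  then show ?thesis using assms by metis
qed

text \<open>Purity of the intersection with the earlier facets, unfolded into descents along graph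
  edges.\<close>

locale shelled_facet_system = facet_system N F d
  for N :: "'n set" and F :: "'n \<Rightarrow> 'a set" and d :: nat +
  fixes idx :: "'n \<Rightarrow> nat"
  assumes inj_idx: "inj_on idx N"
    and shelling_step: "y \<in> N \<Longrightarrow> z \<in> N \<Longrightarrow> idx z < idx y \<Longrightarrow> \<sigma> \<subseteq> F y \<Longrightarrow> \<sigma> \<subseteq> F z \<Longrightarrow>
      \<exists>w. adj y w \<and> idx w < idx y \<and> \<sigma> \<subseteq> F w"
begin

lemma idx_neq: "adj y w \<Longrightarrow> idx y \<noteq> idx w"
  using inj_idx by (auto simp: adj_def inj_on_def)

text \<open>In the cycle formed by the star of a codimension two face, descents and ascents are equally
  many, so that a single source forces a single sink.\<close>

lemma star_unique_sink:
  assumes \<tau>: "card \<tau> + 2 = d" and t: "t \<in> star \<tau>"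
    and sink: "\<And>w. w \<in> star \<tau> \<Longrightarrow> adj t w \<Longrightarrow> idx w < idx t" and y: "y \<in> star \<tau>"
  shows "idx y \<le> idx t"
proof (rule ccontr)
  assume "\<not> idx y \<le> idx t"
  let ?S = "star \<tau>"
  define dn where "dn v = card {w \<in> ?S. adj v w \<and> idx w < idx v}" for v
  define up where "up v = card {w \<in> ?S. adj v w \<and> idx v < idx w}" for v
  have two: "card {w \<in> ?S. adj v w} = 2" if "v \<in> ?S" for v
    using star_two_neighbours[OF that \<tau>] by (metis card_2_iff)
  have dnup: "dn v + up v = 2" if "v \<in> ?S" for v
  proof -
    have "dn v + up v = card ({w \<in> ?S. adj v w \<and> idx w < idx v} \<union> {w \<in> ?S. adj v w \<and> idx v < idx w})"
      unfolding dn_def up_def by (rule card_Un_disjoint[symmetric]) auto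
    also have "{w \<in> ?S. adj v w \<and> idx w < idx v} \<union> {w \<in> ?S. adj v w \<and> idx v < idx w} = {w \<in> ?S. adj v w}"
      using idx_neq by fastforce
    finally show ?thesis using two[OF that] by simp
  qed
  have "(\<Sum>v\<in>?S. dn v) = card (SIGMA v:?S. {w \<in> ?S. adj v w \<and> idx w < idx v})"
    unfolding dn_def by (subst card_SigmaI) auto
  also have "\<dots> = card (prod.swap ` (SIGMA v:?S. {w \<in> ?S. adj v w \<and> idx w < idx v}))"
    by (simp add: card_image)
  also have "prod.swap ` (SIGMA v:?S. {w \<in> ?S. adj v w \<and> idx w < idx v}) =
      (SIGMA v:?S. {w \<in> ?S. adj v w \<and> idx v < idx w})"
    using adj_sym by (auto simp: image_iff)
  also have "card \<dots> = (\<Sum>v\<in>?S. up v)"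
    unfolding up_def by (subst card_SigmaI) auto
  finally have "(\<Sum>v\<in>?S. dn v) = (\<Sum>v\<in>?S. up v)" .
  moreover have "(\<Sum>v\<in>?S. dn v) + (\<Sum>v\<in>?S. up v) = 2 * card ?S"
    by (simp add: sum.distrib[symmetric] dnup)
  ultimately have sum_dn: "(\<Sum>v\<in>?S. dn v) = card ?S" by simp
  obtain m where m: "m \<in> ?S" "\<And>u. u \<in> ?S \<Longrightarrow> idx m \<le> idx u"
    using ex_has_least_nat[of "\<lambda>u. u \<in> ?S" y idx] y by blast
  have "Max (idx ` ?S) \<in> idx ` ?S" using y by (intro Max_in) auto
  then obtain M where M: "M \<in> ?S" "\<And>u. u \<in> ?S \<Longrightarrow> idx u \<le> idx M"
    by (metis Max_ge finite_imageI finite_star image_iff)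
  have "M \<noteq> t" using M(2)[OF y] \<open>\<not> idx y \<le> idx t\<close> by auto
  have full: "dn v = 2" if "v \<in> ?S" "\<And>w. w \<in> ?S \<Longrightarrow> adj v w \<Longrightarrow> idx w < idx v" for v
  proof -
    have "{w \<in> ?S. adj v w \<and> idx w < idx v} = {w \<in> ?S. adj v w}" using that by blast
    then show ?thesis using two[OF that(1)] by (simp add: dn_def)
  qed
  have dM: "dn M = 2" using full[OF M(1)] M(2) idx_neq by (metis le_neq_implies_less)
  have dt: "dn t = 2" using full[OF t sink] .
  have dm: "dn v \<ge> 1" if "v \<in> ?S" "v \<noteq> m" for v
  proof -
    have N: "v \<in> N" "m \<in> N" "\<tau> \<subseteq> F v" "\<tau> \<subseteq> F m" using m(1) that(1) by (auto simp: star_def)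
    then have "idx v \<noteq> idx m" using that(2) inj_idx by (auto simp: inj_on_def)
    then have "idx m < idx v" using m(2)[OF that(1)] by simp
    then obtain w where "adj v w" "idx w < idx v" "\<tau> \<subseteq> F w"
      using shelling_step[OF N(1,2) _ N(3,4)] by blast
    then have "w \<in> {w \<in> ?S. adj v w \<and> idx w < idx v}" by (auto simp: star_def adj_def)
    then have "{w \<in> ?S. adj v w \<and> idx w < idx v} \<noteq> {}" by blast
    then show ?thesis unfolding dn_def by (simp add: Suc_le_eq card_gt_0_iff)
  qed
  \<comment> \<open>Descents number \<open>card ?S\<close>. Every facet but \<open>m\<close> has
    one, and the two sinks \<open>t\<close> and \<open>M\<close> each have a second: one too
    many.\<close>
  have "card ?S + 2 = (\<Sum>v\<in>?S. 1 + (if v = t then 1 else 0) + (if v = M then 1 else 0))"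
    unfolding sum.distrib using t M(1) by simp
  also have "\<dots> \<le> (\<Sum>v\<in>?S. dn v + (if v = m then 1 else 0))"
    by (rule sum_mono) (use dM dt dm \<open>M \<noteq> t\<close> in auto)
  also have "\<dots> = card ?S + 1" unfolding sum.distrib using m(1) sum_dn by simp
  finally show False by simp
qed

end


section \<open>Counting local minima on vertex stars\<close>

context facet_system
begin

text \<open>The order is a parameter because each complex is also tested against the shelling of the
  other.\<close>

definition sources :: "('n \<Rightarrow> nat) \<Rightarrow> 'a \<Rightarrow> 'n set" where
  "sources idx v = {y \<in> N. v \<in> F y \<and> (\<forall>w. adj y w \<longrightarrow> v \<in> F w \<longrightarrow> idx y < idx w)}"

lemma finite_vertices: "finite (\<Union>(F ` N))"
  using finite_N finite_F by blast

lemma first_in_sources: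
  assumes "inj_on idx N" "y \<in> N" "v \<in> F y"
  obtains m where "m \<in> sources idx v" "idx m \<le> idx y"
proof -
  obtain m where m: "m \<in> N" "v \<in> F m" "\<And>u. u \<in> N \<Longrightarrow> v \<in> F u \<Longrightarrow> idx m \<le> idx u"
    using ex_has_least_nat[of "\<lambda>u. u \<in> N \<and> v \<in> F u" y idx] assms by blast
  have "idx m < idx w" if "adj m w" "v \<in> F w" for w
  proof -
    have "w \<in> N" "m \<noteq> w" using that by (auto simp: adj_def)
    then have "idx m \<noteq> idx w" using assms(1) m(1) by (auto simp: inj_on_def)
    then show ?thesis using m(3)[OF \<open>w \<in> N\<close> that(2)] by simp
  qed
  then have "m \<in> sources idx v" using m by (simp add: sources_def)
  then show ?thesis using that m(3) assms by blast
qed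

text \<open>The right-hand side only mentions the facet-ridge graph and the order.\<close>

lemma sum_card_sources:
  assumes "inj_on idx N"
  shows "(\<Sum>v\<in>\<Union>(F ` N). card (sources idx v)) =
    (\<Sum>y\<in>N. card {w. adj y w \<and> (\<forall>u. adj y u \<longrightarrow> idx u < idx y \<longrightarrow> u = w)})"
proof -
  let ?V = "\<Union>(F ` N)"
  have fin: "finite (sources idx v)" for v unfolding sources_def using finite_N by simp
  have "(\<Sum>v\<in>?V. card (sources idx v)) = card (SIGMA v:?V. sources idx v)"
    using fin finite_vertices by (subst card_SigmaI) auto
  also have "\<dots> = card (prod.swap ` (SIGMA v:?V. sources idx v))"
    by (simp add: card_image)
  also have "prod.swap ` (SIGMA v:?V. sources idx v) = (SIGMA y:N. {v \<in> F y. y \<in> sources idx v})"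
    by (auto simp: image_iff sources_def)
  also have "card \<dots> = (\<Sum>y\<in>N. card {v \<in> F y. y \<in> sources idx v})"
    using finite_N finite_F by (subst card_SigmaI) auto
  also have "\<dots> = (\<Sum>y\<in>N. card {w. adj y w \<and> (\<forall>u. adj y u \<longrightarrow> idx u < idx y \<longrightarrow> u = w)})"
  proof (rule sum.cong)
    fix y assume y: "y \<in> N"
    \<comment> \<open>\<open>across y v\<close> is the only neighbour of \<open>y\<close> that
      misses \<open>v\<close>, so it is the only one allowed to come earlier.\<close>
    have src: "y \<in> sources idx v \<longleftrightarrow> (\<forall>u. adj y u \<longrightarrow> idx u < idx y \<longrightarrow> u = across y v)"
      if v: "v \<in> F y" for v
    proof -
      have "v \<in> F u \<longleftrightarrow> u \<noteq> across y v" if yu: "adj y u" for u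
      proof -
        obtain x where "x \<in> F y" "u = across y x" using yu by (rule adj_imp_across)
        then show ?thesis
          using Int_across[OF y] bij_betw_across[OF y] v by (auto simp: bij_betw_def inj_on_def)
      qed
      moreover have "idx u \<noteq> idx y" if "adj y u" for u
        using that assms by (auto simp: adj_def inj_on_def)
      ultimately show ?thesis using v y unfolding sources_def
        by (smt (verit) linorder_neqE_nat mem_Collect_eq order_less_asym')
    qed
    define Q where "Q w \<longleftrightarrow> (\<forall>u. adj y u \<longrightarrow> idx u < idx y \<longrightarrow> u = w)" for w
    have "{v \<in> F y. y \<in> sources idx v} = {v \<in> F y. Q (across y v)}" using src by (auto simp: Q_def)
    moreover have "across y ` {v \<in> F y. Q (across y v)} = {w \<in> across y ` F y. Q w}" by blast
    moreover have "inj_on (across y) {v \<in> F y. Q (across y v)}"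
      using bij_betw_across[OF y] by (auto simp: bij_betw_def inj_on_def)
    ultimately have "bij_betw (across y) {v \<in> F y. y \<in> sources idx v} {w. adj y w \<and> Q w}"
      using bij_betw_across[OF y] by (simp add: bij_betw_def)
    then show "card {v \<in> F y. y \<in> sources idx v} =
        card {w. adj y w \<and> (\<forall>u. adj y u \<longrightarrow> idx u < idx y \<longrightarrow> u = w)}"
      unfolding Q_def by (rule bij_betw_same_card)
  qed simp
  finally show ?thesis .
qed

text \<open>Holds for every order, since each vertex star has a first facet.\<close>

lemma card_vertices_le_sum_sources:
  assumes "inj_on idx N"
  shows "card (\<Union>(F ` N)) \<le> (\<Sum>v\<in>\<Union>(F ` N). card (sources idx v))"
proof -
  have "1 \<le> card (sources idx v)" if v: "v \<in> \<Union>(F ` N)" for v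
  proof -
    obtain y where "y \<in> N" "v \<in> F y" using v by blast
    then obtain m where "m \<in> sources idx v" using first_in_sources[OF assms] by blast
    moreover have "finite (sources idx v)" unfolding sources_def using finite_N by simp
    ultimately show ?thesis by (metis One_nat_def Suc_leI card_gt_0_iff empty_iff)
  qed
  then have "(\<Sum>v\<in>\<Union>(F ` N). 1) \<le> (\<Sum>v\<in>\<Union>(F ` N). card (sources idx v))"
    by (rule sum_mono)
  then show ?thesis by simp
qed

end

context shelled_facet_system
begin

text \<open>Of two sources of the same star, the later one would have an earlier neighbour in that
  star by the shelling.\<close>

lemma sum_sources_shelling:
  "(\<Sum>v\<in>\<Union>(F ` N). card (sources idx v)) \<le> card (\<Union>(F ` N))"
proof -
  have "card (sources idx v) \<le> 1" for v
  proof -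
    have "y = z" if yz: "y \<in> sources idx v" "z \<in> sources idx v" for y z
    proof -
      have less: "\<not> idx b < idx a" if ab: "a \<in> sources idx v" "b \<in> sources idx v" for a b
      proof
        assume "idx b < idx a"
        then obtain w where "adj a w" "idx w < idx a" "v \<in> F w"
          using shelling_step[of a b "{v}"] ab by (auto simp: sources_def)
        then show False using ab(1) by (auto simp: sources_def dest: order_less_asym')
      qed
      have "idx y = idx z" using less[OF yz] less[OF yz(2,1)] by simp
      then show ?thesis using yz inj_idx by (auto simp: sources_def inj_on_def)
    qed
    moreover have "finite (sources idx v)" unfolding sources_def using finite_N by simp
    ultimately show ?thesis by (simp add: card_le_Suc0_iff_eq)
  qed
  then have "(\<Sum>v\<in>\<Union>(F ` N). card (sources idx v)) \<le> (\<Sum>v\<in>\<Union>(F ` N). 1)"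
    by (intro sum_mono) blast
  then show ?thesis by simp
qed

end

text \<open>Kalai's counting argument, restricted to vertices: among all orders of the facets, the
  shellings are those with as few sources of vertex stars as possible, and this number can be read
  off from the graph. Hence a shelling of one complex is as good as a shelling of the other.\<close>

lemma vertex_descent_transfer:
  assumes A: "shelled_facet_system N F d idx" and B: "shelled_facet_system N G d idx'"
    and adj: "\<And>y w. facet_system.adj N G d y w \<longleftrightarrow> facet_system.adj N F d y w"
    and yz: "y \<in> N" "z \<in> N" "idx z < idx y" "\<alpha> \<in> G y" "\<alpha> \<in> G z"
  shows "\<exists>w. facet_system.adj N F d y w \<and> idx w < idx y \<and> \<alpha> \<in> G w"
proof (rule ccontr)
  assume none: "\<not> ?thesis"
  interpret A: shelled_facet_system N F d idx by fact
  interpret B: shelled_facet_system N G d idx' by fact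
  let ?V = "\<Union>(F ` N)" and ?W = "\<Union>(G ` N)"
  have same: "(\<Sum>v\<in>?V. card (A.sources i v)) = (\<Sum>v\<in>?W. card (B.sources i v))"
    if "inj_on i N" for i
    using A.sum_card_sources[OF that] B.sum_card_sources[OF that] adj by simp
  \<comment> \<open>Switching complexes twice, once for each shelling, shows that \<open>idx\<close>
    attains the minimum possible number of sources on the second complex too.\<close>
  have "(\<Sum>v\<in>?W. card (B.sources idx v)) \<le> card ?V"
    using same[OF A.inj_idx] A.sum_sources_shelling by simp
  also have "\<dots> \<le> (\<Sum>v\<in>?V. card (A.sources idx' v))"
    by (rule A.card_vertices_le_sum_sources[OF B.inj_idx])
  also have "\<dots> \<le> card ?W" using same[OF B.inj_idx] B.sum_sources_shelling by simp
  finally have le: "(\<Sum>v\<in>?W. card (B.sources idx v)) \<le> (\<Sum>v\<in>?W. 1)" by simp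
  have ge: "1 \<le> card (B.sources idx v)" if v: "v \<in> ?W" for v
  proof -
    obtain y where "y \<in> N" "v \<in> G y" using v by blast
    then obtain m where "m \<in> B.sources idx v" using B.first_in_sources[OF A.inj_idx] by blast
    moreover have "finite (B.sources idx v)" unfolding B.sources_def using B.finite_N by simp
    ultimately show ?thesis by (metis One_nat_def Suc_leI card_gt_0_iff empty_iff)
  qed
  have "card (B.sources idx \<alpha>) \<le> 1"
  proof (rule ccontr)
    assume "\<not> ?thesis"
    then have "1 < card (B.sources idx \<alpha>)" "\<alpha> \<in> ?W" using yz by auto
    then have "(\<Sum>v\<in>?W. 1) < (\<Sum>v\<in>?W. card (B.sources idx v))"
      using ge B.finite_vertices by (intro sum_strict_mono_ex1) blast+
    then show False using le by simp
  qed
  moreover have "finite (B.sources idx \<alpha>)" unfolding B.sources_def using B.finite_N by simp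
  ultimately have uniq: "u = v" if "u \<in> B.sources idx \<alpha>" "v \<in> B.sources idx \<alpha>" for u v
    using that by (simp add: card_le_Suc0_iff_eq)
  \<comment> \<open>Without a descent \<open>y\<close> is a source, and so is the first facet of the
    star of \<alpha>, which comes no later than \<open>z\<close>.\<close>
  have "y \<in> B.sources idx \<alpha>"
  proof -
    have "idx y < idx w" if "A.adj y w" "\<alpha> \<in> G w" for w
      using none that A.idx_neq[OF that(1)] by (meson linorder_neqE_nat)
    then show ?thesis unfolding B.sources_def using yz adj by simp
  qed
  moreover obtain m where "m \<in> B.sources idx \<alpha>" "idx m \<le> idx z"
    using B.first_in_sources[OF A.inj_idx yz(2,5)] .
  ultimately show False using uniq yz(3) by (metis leD)
qed

section \<open>Two facet systems with the same graph\<close>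

text \<open>Asymmetric on purpose: the order shells the first system, while for the second only
  descents inside vertex stars are kept.\<close>

locale facet_pair = A: shelled_facet_system N F d idx + B: facet_system N G d
  for N :: "'n set" and F :: "'n \<Rightarrow> 'a set" and d :: nat and idx :: "'n \<Rightarrow> nat"
    and G :: "'n \<Rightarrow> 'b set" +
  assumes same_adj: "B.adj y w \<longleftrightarrow> A.adj y w"
    and vertex_descent: "y \<in> N \<Longrightarrow> z \<in> N \<Longrightarrow> idx z < idx y \<Longrightarrow> \<alpha> \<in> G y \<Longrightarrow> \<alpha> \<in> G z \<Longrightarrow>
      \<exists>w. A.adj y w \<and> idx w < idx y \<and> \<alpha> \<in> G w"
begin

text \<open>The vertices of a facet correspond to its neighbours in the graph; this identifies the
  vertices of the two facets at a node.\<close>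

definition relabel :: "'n \<Rightarrow> 'a \<Rightarrow> 'b" where
  "relabel y = inv_into (G y) (B.across y) \<circ> A.across y"

lemma bij_relabel: "y \<in> N \<Longrightarrow> bij_betw (relabel y) (F y) (G y)"
  unfolding relabel_def
  by (rule bij_betw_trans[OF A.bij_betw_across]) (use B.bij_betw_across[of y] in
      \<open>simp_all add: same_adj bij_betw_inv_into\<close>)

lemma relabel_in: "y \<in> N \<Longrightarrow> v \<in> F y \<Longrightarrow> relabel y v \<in> G y"
  using bij_relabel bij_betwE by metis

lemma relabel_inj: "y \<in> N \<Longrightarrow> u \<in> F y \<Longrightarrow> v \<in> F y \<Longrightarrow> relabel y u = relabel y v \<Longrightarrow> u = v"
  using bij_relabel by (metis bij_betw_def inj_onD)

lemma relabel_surj: "y \<in> N \<Longrightarrow> \<alpha> \<in> G y \<Longrightarrow> \<exists>v\<in>F y. relabel y v = \<alpha>"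
  using bij_relabel by (metis bij_betw_def imageE)

lemma across_relabel:
  assumes "y \<in> N" "v \<in> F y"
  shows "B.across y (relabel y v) = A.across y v"
proof -
  have "A.across y v \<in> B.across y ` G y"
    using B.bij_betw_across[OF assms(1)] A.adj_across[OF assms] by (auto simp: bij_betw_def same_adj)
  then show ?thesis by (simp add: relabel_def f_inv_into_f)
qed

text \<open>On both sides the ridge omits the vertex opposite \<open>w\<close>. So
  \<open>relabel y\<close> and \<open>relabel w\<close> agree on the ridge as a set, though perhaps
  not vertex by vertex.\<close>

lemma relabel_ridge:
  assumes "A.adj y w"
  shows "relabel y ` (F y \<inter> F w) = G y \<inter> G w"
proof -
  have y: "y \<in> N" using assms A.adj_in_N by blast
  obtain v where v: "v \<in> F y" "w = A.across y v" using assms by (rule A.adj_imp_across)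
  have "relabel y ` (F y - {v}) = G y - {relabel y v}"
    using bij_relabel[OF y] v(1) by (auto simp: bij_betw_def inj_on_def)
  then show ?thesis
    using A.Int_across[OF y v(1)] B.Int_across[OF y relabel_in[OF y v(1)]] across_relabel[OF y v(1)] v(2)
    by simp
qed

lemma relabel_in_adj:
  assumes "A.adj y w" "v \<in> F y" "v \<in> F w"
  shows "relabel y v \<in> G y \<inter> G w"
  using relabel_ridge[OF assms(1)] assms by blast

lemma relabel_in_adj_iff:
  assumes "A.adj y w" "v \<in> F y"
  shows "relabel y v \<in> G w \<longleftrightarrow> v \<in> F w"
proof -
  have y: "y \<in> N" using assms A.adj_in_N by blast
  have "relabel y v \<in> relabel y ` (F y \<inter> F w) \<longleftrightarrow> v \<in> F y \<inter> F w"
    using relabel_inj[OF y] assms(2) by blast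
  then show ?thesis using relabel_ridge[OF assms(1)] relabel_in[OF y assms(2)] assms(2) by blast
qed

text \<open>For a face of codimension two: the cycle of facets around it is also the cycle of facets
  around a face of the second complex.\<close>

definition flat :: "'a set \<Rightarrow> bool" where
  "flat \<tau> \<longleftrightarrow> (\<forall>y w x. y \<in> A.star \<tau> \<longrightarrow> w \<in> A.star \<tau> \<longrightarrow> A.adj y w \<longrightarrow> x \<notin> \<tau> \<longrightarrow>
     F y \<inter> F w = insert x \<tau> \<longrightarrow> relabel y x = relabel w x)"

definition flat_below :: "nat \<Rightarrow> bool" where
  "flat_below n \<longleftrightarrow> (\<forall>\<tau>. card \<tau> + 2 = d \<longrightarrow> (\<forall>y\<in>A.star \<tau>. idx y < n) \<longrightarrow> flat \<tau>)"

text \<open>Testing against one \<alpha> makes labels Boolean: this is a cochain on the edges with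
  values modulo 2, and a potential is a function on facets with this coboundary.\<close>

definition jump :: "'a \<Rightarrow> 'b \<Rightarrow> 'n \<Rightarrow> 'n \<Rightarrow> bool" where
  "jump a \<alpha> y w \<longleftrightarrow> a \<in> F y \<and> a \<in> F w \<and> ((relabel y a = \<alpha>) \<noteq> (relabel w a = \<alpha>))"

text \<open>The truth value of \<open>relabel y a = \<alpha>\<close> makes sense for facets containing \<open>a\<close>, and also for
  facets whose partner contains \<open>\<alpha>\<close>. A potential extends both to all facets.\<close>

definition potential :: "'a \<Rightarrow> 'b \<Rightarrow> nat \<Rightarrow> ('n \<Rightarrow> bool) \<Rightarrow> bool" where
  "potential a \<alpha> n k \<longleftrightarrow> (\<forall>y w. A.adj y w \<longrightarrow> idx y < n \<longrightarrow> idx w < n \<longrightarrow>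
     (k y \<noteq> k w \<longleftrightarrow> jump a \<alpha> y w))"

section \<open>Existence and normalisation of potentials\<close>

lemma jump_sym: "jump a \<alpha> y w \<longleftrightarrow> jump a \<alpha> w y"
  by (auto simp: jump_def)

text \<open>In a flat star the vertices outside \<tau> keep their labels across ridges, so only
  \<open>a\<close> in \<tau> can jump; such an \<open>a\<close> lies in all facets of the star,
  which gives a local potential.\<close>

lemma jump_in_flat_star:
  assumes "flat \<tau>" "card \<tau> + 2 = d" "y \<in> A.star \<tau>" "w \<in> A.star \<tau>" "A.adj y w"
  shows "jump a \<alpha> y w \<longleftrightarrow> (a \<in> \<tau> \<and> relabel y a = \<alpha>) \<noteq> (a \<in> \<tau> \<and> relabel w a = \<alpha>)"
proof -
  obtain x where x: "x \<notin> \<tau>" "F y \<inter> F w = insert x \<tau>"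
    using A.star_neighbour_ridge[OF assms(3-5,2)] .
  then have "relabel y x = relabel w x" using assms unfolding flat_def by blast
  moreover have "a \<in> F y \<and> a \<in> F w \<longleftrightarrow> a = x \<or> a \<in> \<tau>" using x(2) by blast
  ultimately show ?thesis using x(1) unfolding jump_def by auto
qed

text \<open>Two earlier neighbours of \<open>t\<close> prescribe the same value of the potential at
  \<open>t\<close>, because they lie on a common cycle whose sink is \<open>t\<close>.\<close>

lemma jump_sum_independent:
  assumes "flat_below (Suc n)" "potential a \<alpha> n k" "t \<in> N" "idx t = n"
    and y: "A.adj t y" "idx y < n" and y': "A.adj t y'" "idx y' < n"
  shows "(k y \<noteq> jump a \<alpha> t y) = (k y' \<noteq> jump a \<alpha> t y')"
proof (cases "y = y'")
  case False
  obtain r where r: "r \<in> F t" "y = A.across t r" using y(1) by (rule A.adj_imp_across)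
  obtain r' where r': "r' \<in> F t" "y' = A.across t r'" using y'(1) by (rule A.adj_imp_across)
  have "r \<noteq> r'" using False r r' by auto
  \<comment> \<open>The codimension two face contained in \<open>t\<close>, \<open>y\<close> and
    \<open>y'\<close>.\<close>
  define \<omega> where "\<omega> = F t - {r, r'}"
  have c: "card \<omega> + 2 = d"
  proof -
    have "card (F t) = card \<omega> + card {r, r'}" unfolding \<omega>_def
      using r r' A.finite_F[OF assms(3)]
      by (metis add.commute card_Diff_subset card_mono finite.emptyI finite.insertI insert_subset empty_subsetI le_add_diff_inverse)
    then show ?thesis using A.card_F[OF assms(3)] \<open>r \<noteq> r'\<close> by simp
  qed
  have st: "t \<in> A.star \<omega>" "y \<in> A.star \<omega>" "y' \<in> A.star \<omega>"
    using A.across[OF assms(3) r(1)] A.across[OF assms(3) r'(1)] r r' assms(3)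
    unfolding A.star_def \<omega>_def by auto
  have nbs: "w = y \<or> w = y'" if "w \<in> A.star \<omega>" "A.adj t w" for w
  proof -
    obtain p q where "{w \<in> A.star \<omega>. A.adj t w} = {A.across t p, A.across t q}"
      using A.star_two_neighbours[OF st(1) c] by metis
    moreover have "{y, y'} \<subseteq> {w \<in> A.star \<omega>. A.adj t w}" using st y y' by blast
    ultimately have "{w \<in> A.star \<omega>. A.adj t w} = {y, y'}" using False by auto
    then show ?thesis using that by blast
  qed
  have below: "idx w \<le> n" if "w \<in> A.star \<omega>" for w
    using A.star_unique_sink[OF c st(1) _ that] nbs y y' assms(4) by metis
  then have "flat \<omega>" using assms(1) c unfolding flat_below_def by (metis le_imp_less_Suc)
  note jump = jump_in_flat_star[OF this c]
  have below': "idx w < n" if "w \<in> A.star \<omega> - {t}" for w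
    using below[of w] that assms(3,4) A.inj_idx unfolding A.star_def inj_on_def
    by (metis (no_types, lifting) DiffE insertI1 le_neq_implies_less mem_Collect_eq)
  \<comment> \<open>On the star without \<open>t\<close>, the difference of \<open>k\<close> and the
    local potential is constant.\<close>
  have "(k y \<noteq> (a \<in> \<omega> \<and> relabel y a = \<alpha>)) = (k y' \<noteq> (a \<in> \<omega> \<and> relabel y' a = \<alpha>))"
  proof (rule A.star_cut_constant[OF c st(1) st(2) y(1) st(3) y'(1) False,
        where g = "\<lambda>v. k v \<noteq> (a \<in> \<omega> \<and> relabel v a = \<alpha>)"])
    fix v w assume vw: "v \<in> A.star \<omega> - {t}" "w \<in> A.star \<omega> - {t}" "A.adj v w"
    then have "k v \<noteq> k w \<longleftrightarrow> jump a \<alpha> v w"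
      using assms(2) below' unfolding potential_def by blast
    then show "(k v \<noteq> (a \<in> \<omega> \<and> relabel v a = \<alpha>)) = (k w \<noteq> (a \<in> \<omega> \<and> relabel w a = \<alpha>))"
      using jump[of v w a \<alpha>] vw by auto
  qed
  then show ?thesis using jump[OF st(1,2) y(1)] jump[OF st(1,3) y'(1)] by auto
qed simp

lemma ex_potential:
  assumes "flat_below n"
  shows "\<exists>k. potential a \<alpha> n k"
  using assms
proof (induction n)
  case 0
  then show ?case by (simp add: potential_def)
next
  case (Suc n)
  have "flat_below n" using Suc.prems less_SucI unfolding flat_below_def by fast
  then obtain k where k: "potential a \<alpha> n k" using Suc.IH by blast
  show ?case
  proof (cases "\<exists>t\<in>N. idx t = n \<and> (\<exists>y. A.adj t y \<and> idx y < n)")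
    case False
    \<comment> \<open>Position \<open>n\<close> is vacant or holds a facet without earlier
      neighbours, so no edge is added.\<close>
    have "idx y < n \<and> idx w < n" if "A.adj y w" "idx y < Suc n" "idx w < Suc n" for y w
      using that False A.adj_in_N A.adj_sym A.idx_neq[OF that(1)] by (metis less_Suc_eq)
    then have "potential a \<alpha> (Suc n) k" using k unfolding potential_def by blast
    then show ?thesis by blast
  next
    case True
    then obtain t y0 where t: "t \<in> N" "idx t = n" "A.adj t y0" "idx y0 < n" by blast
    have uniq: "w = t" if "w \<in> N" "idx w = n" for w
      using that t A.inj_idx by (simp add: inj_on_def)
    \<comment> \<open>The value at \<open>t\<close> is forced by the neighbour \<open>y0\<close>;
      \<open>jump_sum_independent\<close> makes it fit the others.\<close>
    define k' where "k' = k(t := (k y0 \<noteq> jump a \<alpha> t y0))"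
    have kt: "k' t \<noteq> k' y \<longleftrightarrow> jump a \<alpha> t y" if "A.adj t y" "idx y < n" for y
      using jump_sum_independent[OF Suc.prems k t(1,2) that t(3,4)] that t unfolding k'_def by auto
    have "k' y \<noteq> k' w \<longleftrightarrow> jump a \<alpha> y w" if yw: "A.adj y w" "idx y < Suc n" "idx w < Suc n" for y w
    proof -
      consider "y = t" "idx w < n" | "w = t" "idx y < n" | "idx y < n" "idx w < n"
        using yw uniq A.adj_in_N A.idx_neq[OF yw(1)] by (metis less_Suc_eq)
      then show ?thesis
      proof cases
        case 1
        then show ?thesis using kt yw by blast
      next
        case 2
        then show ?thesis using kt[of y] yw A.adj_sym jump_sym by blast
      next
        case 3
        then have "y \<noteq> t" "w \<noteq> t" using t by auto
        then show ?thesis using 3 k yw unfolding potential_def k'_def by auto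
      qed
    qed
    then have "potential a \<alpha> (Suc n) k'" unfolding potential_def by blast
    then show ?thesis by blast
  qed
qed

text \<open>A global flip makes the value at \<open>z\<close> correct. As \<open>z\<close> lies in
  the star of \<open>a\<close> and its partner in that of \<alpha>, correctness spreads over the
  first star by the shelling and over the second by \<open>vertex_descent\<close>.\<close>

lemma ex_normalised_potential:
  assumes fb: "flat_below n" and z: "z \<in> N" "idx z < n" "a \<in> F z" "\<alpha> \<in> G z"
  shows "\<exists>k. potential a \<alpha> n k \<and>
    (\<forall>y\<in>N. idx y < n \<longrightarrow> a \<in> F y \<longrightarrow> (k y \<longleftrightarrow> relabel y a = \<alpha>)) \<and>
    (\<forall>y\<in>N. idx y < n \<longrightarrow> \<alpha> \<in> G y \<longrightarrow> (k y \<longleftrightarrow> a \<in> F y \<and> relabel y a = \<alpha>))"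
proof -
  obtain k0 where k0: "potential a \<alpha> n k0" using ex_potential[OF fb] by blast
  define k where "k y = (k0 y \<noteq> (k0 z \<noteq> (relabel z a = \<alpha>)))" for y
  have pot: "potential a \<alpha> n k" using k0 unfolding potential_def k_def by auto
  have kz: "k z \<longleftrightarrow> relabel z a = \<alpha>" by (auto simp: k_def)
  have 1: "k y \<longleftrightarrow> relabel y a = \<alpha>" if "y \<in> N" "idx y < n" "a \<in> F y" for y
  proof -
    let ?S = "{y \<in> N. idx y < n \<and> a \<in> F y}"
    have "(k y = (relabel y a = \<alpha>)) = (k z = (relabel z a = \<alpha>))"
    proof (rule const_by_descent[where S = ?S and idx = idx and R = A.adj])
      show "inj_on idx ?S" using A.inj_idx by (rule inj_on_subset) auto
    next
      fix u v assume "u \<in> ?S" "v \<in> ?S" "idx v < idx u"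
      then show "\<exists>w\<in>?S. A.adj u w \<and> idx w < idx u"
        using A.shelling_step[of u v "{a}"] A.adj_in_N by fastforce
    next
      fix u w assume uw: "u \<in> ?S" "w \<in> ?S" "A.adj u w"
      then have "k u \<noteq> k w \<longleftrightarrow> jump a \<alpha> u w" using pot unfolding potential_def by blast
      then show "(k u = (relabel u a = \<alpha>)) = (k w = (relabel w a = \<alpha>))"
        using uw unfolding jump_def by auto
    qed (use that z in auto)
    then show ?thesis using kz by auto
  qed
  have 2: "k y \<longleftrightarrow> a \<in> F y \<and> relabel y a = \<alpha>" if "y \<in> N" "idx y < n" "\<alpha> \<in> G y" for y
  proof -
    let ?S = "{y \<in> N. idx y < n \<and> \<alpha> \<in> G y}"
    let ?P = "\<lambda>y. a \<in> F y \<and> relabel y a = \<alpha>"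
    have "(k y = ?P y) = (k z = ?P z)"
    proof (rule const_by_descent[where S = ?S and idx = idx and R = A.adj])
      show "inj_on idx ?S" using A.inj_idx by (rule inj_on_subset) auto
    next
      fix u v assume "u \<in> ?S" "v \<in> ?S" "idx v < idx u"
      then show "\<exists>w\<in>?S. A.adj u w \<and> idx w < idx u"
        using vertex_descent[of u v \<alpha>] A.adj_in_N by fastforce
    next
      fix u w assume uw: "u \<in> ?S" "w \<in> ?S" "A.adj u w"
      then have "k u \<noteq> k w \<longleftrightarrow> jump a \<alpha> u w" using pot unfolding potential_def by blast
      \<comment> \<open>If \<open>a\<close> has label \<alpha> in \<open>u\<close> and \<alpha> lies
        in \<open>G w\<close>, then \<open>a\<close> lies in \<open>F w\<close>; hence
        \<open>?P\<close> changes only where there is a jump.\<close>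
      moreover have "?P u \<Longrightarrow> a \<in> F w" "?P w \<Longrightarrow> a \<in> F u"
        using relabel_in_adj_iff[of u w a] relabel_in_adj_iff[of w u a] uw A.adj_sym by auto
      ultimately show "(k u = ?P u) = (k w = ?P w)" unfolding jump_def by blast
    qed (use that z in auto)
    then show ?thesis using kz z by auto
  qed
  show ?thesis using pot 1 2 by blast
qed

text \<open>Both relabellings map the ridge bijectively onto the same set, so the label of
  \<open>x\<close> is what the image of \<tau> leaves over.\<close>

lemma relabel_eq_iff_on_ridge:
  assumes "A.adj y w" "F y \<inter> F w = insert x \<tau>" "x \<notin> \<tau>"
  shows "relabel y x = relabel w x \<longleftrightarrow> relabel y ` \<tau> = relabel w ` \<tau>"
proof -
  have N: "y \<in> N" "w \<in> N" using assms A.adj_in_N by auto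
  have *: "relabel u ` \<tau> = (G y \<inter> G w) - {relabel u x}" "relabel u x \<in> G y \<inter> G w"
    if "u = y \<or> u = w" for u
  proof -
    have r: "relabel u ` insert x \<tau> = G y \<inter> G w"
      using relabel_ridge[OF assms(1)] relabel_ridge[OF A.adj_sym[OF assms(1)]] assms(2) that
      by (auto simp: Int_commute)
    have "insert x \<tau> \<subseteq> F u" using assms(2) that by auto
    then have "relabel u x \<notin> relabel u ` \<tau>"
      using relabel_inj[of u] N that assms(3) by blast
    then show "relabel u ` \<tau> = (G y \<inter> G w) - {relabel u x}" "relabel u x \<in> G y \<inter> G w"
      unfolding r[symmetric] by auto
  qed
  show ?thesis
    using *(2)[of y] unfolding *(1)[OF disjI1[OF refl]] *(1)[OF disjI2[OF refl]] by auto
qed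

text \<open>If the relabelling failed on the star of \<open>\<tau>\<close>, it would send a vertex \<open>x\<close> of the link of \<open>\<tau>\<close> to
  a vertex \<open>\<alpha>\<close> shared by the partners of the two neighbours of the sink. Following the potential of
  \<open>(x, \<alpha>)\<close> around the cycle to one of these neighbours puts \<open>x\<close> into a third facet through a ridge.\<close>

lemma flat_at_sink:
  assumes fb: "flat_below n" and t: "idx t = n" "t \<in> A.star \<tau>" and c: "card \<tau> + 2 = d"
    and below: "\<And>y. y \<in> A.star \<tau> \<Longrightarrow> idx y \<le> n"
  shows "flat \<tau>"
proof -
  have inN: "y \<in> N" "\<tau> \<subseteq> F y" if "y \<in> A.star \<tau>" for y using that by (auto simp: A.star_def)
  have less_n: "idx y < n" if "y \<in> A.star \<tau>" "y \<noteq> t" for y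
    using below[OF that(1)] that inN t A.inj_idx by (metis inj_onD le_neq_implies_less)
  \<comment> \<open>A vertex outside \<tau> occurs in just two facets of the star, so its potential
    can change across only one ridge.\<close>
  have ends: "u = y \<or> u = w" if "A.adj y w" "F y \<inter> F w = insert x \<tau>" "u \<in> A.star \<tau>" "x \<in> F u"
    for u y w x
    using A.ridge_in_two[OF that(1), of u] that inN[OF that(3)] by auto
  have no_jump: "\<not> jump x \<alpha> u v"
    if "A.adj y w" "F y \<inter> F w = insert x \<tau>" "u \<in> A.star \<tau>" "v \<in> A.star \<tau>" "A.adj u v"
      "{u, v} \<noteq> {y, w}" for x \<alpha> u v y w
    using ends[OF that(1,2,3)] ends[OF that(1,2,4)] that(5,6) unfolding jump_def A.adj_def by blast
  have base: "relabel y ` \<tau> = relabel t ` \<tau>" if y: "y \<in> A.star \<tau>" "A.adj t y" for y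
  proof -
    obtain x where x: "x \<notin> \<tau>" "F t \<inter> F y = insert x \<tau>"
      using A.star_neighbour_ridge[OF t(2) y c] .
    obtain p q where pq: "{w \<in> A.star \<tau>. A.adj t w} = {A.across t p, A.across t q}"
      "A.across t p \<noteq> A.across t q"
      using A.star_two_neighbours[OF t(2) c] by metis
    then obtain y' where y': "y' \<in> A.star \<tau>" "A.adj t y'" "y' \<noteq> y"
      by (metis (no_types, lifting) insertI1 insert_commute mem_Collect_eq)
    have "relabel t x = relabel y x"
    proof (rule ccontr)
      assume neq: "relabel t x \<noteq> relabel y x"
      define \<alpha> where "\<alpha> = relabel y x"
      have xy: "x \<in> F y" "x \<in> F t" using x by auto
      have "\<alpha> \<in> G t \<inter> G y" using relabel_in_adj[OF A.adj_sym[OF y(2)] xy] by (auto simp: \<alpha>_def)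
      then have "\<alpha> \<in> relabel t ` insert x \<tau>" using relabel_ridge[OF y(2)] x(2) by simp
      \<comment> \<open>\<open>relabel t\<close> sends \<open>x\<close> elsewhere and so takes
        \<alpha> on \<tau>; therefore \<alpha> also lies in the partner of the other neighbour
        \<open>y'\<close>.\<close>
      then have "\<alpha> \<in> relabel t ` \<tau>" using neq by (auto simp: \<alpha>_def)
      then have \<alpha>: "\<alpha> \<in> G y'" using relabel_in_adj[OF y'(2)] inN[OF y'(1)] inN[OF t(2)] by blast
      have ny: "y \<noteq> t" "y' \<noteq> t" using y y' by (auto simp: A.adj_def)
      obtain k where pot: "potential x \<alpha> n k"
        and kF: "\<forall>y\<in>N. idx y < n \<longrightarrow> x \<in> F y \<longrightarrow> (k y \<longleftrightarrow> relabel y x = \<alpha>)"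
        and kG: "\<forall>y\<in>N. idx y < n \<longrightarrow> \<alpha> \<in> G y \<longrightarrow> (k y \<longleftrightarrow> x \<in> F y \<and> relabel y x = \<alpha>)"
        using ex_normalised_potential[OF fb inN(1)[OF y(1)] less_n[OF y(1) ny(1)] xy(1)
              IntD2[OF \<open>\<alpha> \<in> G t \<inter> G y\<close>]] by blast
      have "k y = k y'"
      proof (rule A.star_cut_constant[where g = k, OF c t(2) y y'(1,2)])
        fix u v assume uv: "u \<in> A.star \<tau> - {t}" "v \<in> A.star \<tau> - {t}" "A.adj u v"
        then have "{u, v} \<noteq> {t, y}" by auto
        then have "\<not> jump x \<alpha> u v" using no_jump[OF y(2) x(2), of u v] uv by auto
        then show "k u = k v" using pot uv(3) less_n[of u] less_n[of v] uv unfolding potential_def by auto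
      qed (use y' in blast)
      \<comment> \<open>\<open>kF\<close> makes \<open>k y\<close> true, so \<open>k y'\<close> is
        true, and \<open>kG\<close> puts \<open>x\<close> into a third facet through the
        ridge.\<close>
      then have "x \<in> F y'"
        using kF[rule_format, OF inN(1)[OF y(1)] less_n[OF y(1) ny(1)] xy(1)]
          kG[rule_format, OF inN(1)[OF y'(1)] less_n[OF y'(1) ny(2)] \<alpha>] by (simp add: \<alpha>_def)
      then show False using ends[OF y(2) x(2) y'(1)] ny y'(3) by blast
    qed
    then show ?thesis using relabel_eq_iff_on_ridge[OF y(2) x(2,1)] by simp
  qed
  \<comment> \<open>Backwards from the sink: a facet not adjacent to \<open>t\<close> is compared
    with a later neighbour.\<close>
  have all: "relabel z ` \<tau> = relabel t ` \<tau>" if "z \<in> A.star \<tau>" for z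
    using that
  proof (induction "n - idx z" arbitrary: z rule: less_induct)
    case less
    note z = less.prems
    show ?case
    proof (cases "z = t \<or> A.adj t z")
      case True
      then show ?thesis using base z by blast
    next
      case False
      then have zn: "idx z < n" using less_n z by blast
      \<comment> \<open>Only \<open>t\<close> is a sink, so \<open>z\<close> has a later
        neighbour.\<close>
      have "\<exists>w. w \<in> A.star \<tau> \<and> A.adj z w \<and> \<not> idx w < idx z"
        using A.star_unique_sink[OF c z _ t(2)] zn t(1) by fastforce
      then obtain w where w: "w \<in> A.star \<tau>" "A.adj z w" "idx z < idx w"
        using A.idx_neq by (meson linorder_neqE_nat)
      have wt: "w \<noteq> t" using False w A.adj_sym by blast
      have wn: "idx w < n" using less_n w wt by blast
      have IH: "relabel w ` \<tau> = relabel t ` \<tau>" using less.hyps[of w] w zn by simp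
      obtain x where x: "x \<notin> \<tau>" "F z \<inter> F w = insert x \<tau>"
        using A.star_neighbour_ridge[OF z w(1,2) c] .
      have "relabel z x = relabel w x"
      proof (rule ccontr)
        assume neq: "relabel z x \<noteq> relabel w x"
        define \<alpha> where "\<alpha> = relabel z x"
        have xz: "x \<in> F z" "x \<in> F w" using x by auto
        have \<alpha>zw: "\<alpha> \<in> G z \<inter> G w" using relabel_in_adj[OF w(2) xz] by (auto simp: \<alpha>_def)
        then have "\<alpha> \<in> relabel w ` insert x \<tau>"
          using relabel_ridge[OF A.adj_sym[OF w(2)]] x(2) by (simp add: Int_commute)
        then have "\<alpha> \<in> relabel w ` \<tau>" using neq by (auto simp: \<alpha>_def)
        then have "\<alpha> \<in> relabel t ` \<tau>" using IH by simp
        then have \<alpha>: "\<alpha> \<in> G y" if "y \<in> A.star \<tau>" "A.adj t y" for y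
          using relabel_in_adj[OF that(2)] inN[OF that(1)] inN[OF t(2)] by blast
        obtain k where pot: "potential x \<alpha> n k"
          and kF: "\<forall>y\<in>N. idx y < n \<longrightarrow> x \<in> F y \<longrightarrow> (k y \<longleftrightarrow> relabel y x = \<alpha>)"
          and kG: "\<forall>y\<in>N. idx y < n \<longrightarrow> \<alpha> \<in> G y \<longrightarrow> (k y \<longleftrightarrow> x \<in> F y \<and> relabel y x = \<alpha>)"
          using ex_normalised_potential[OF fb inN(1)[OF z] zn xz(1) IntD1[OF \<alpha>zw]] by blast
        have kz: "k z" "\<not> k w"
          using kF[rule_format, OF inN(1)[OF z] zn xz(1)] kF[rule_format, OF inN(1)[OF w(1)] wn xz(2)] neq
          by (auto simp: \<alpha>_def)
        \<comment> \<open>Away from \<open>t\<close>, \<open>k\<close> changes only between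
          \<open>z\<close> and \<open>w\<close>, so its true side reaches a neighbour of
          \<open>t\<close>.\<close>
        have "\<exists>y. y \<in> A.star \<tau> \<and> A.adj t y \<and> k y"
        proof (rule A.star_cut_escape[where g = k, OF c t(2) _ _ w(2) kz])
          show "z \<in> A.star \<tau> - {t}" "w \<in> A.star \<tau> - {t}" using z w wt False by auto
          fix u v assume uv: "u \<in> A.star \<tau> - {t}" "v \<in> A.star \<tau> - {t}" "A.adj u v" "{u, v} \<noteq> {z, w}"
          then have "\<not> jump x \<alpha> u v" using no_jump[OF w(2) x(2), of u v] by auto
          then show "k u = k v"
            using pot uv(3) less_n[of u] less_n[of v] uv unfolding potential_def by auto
        qed
        then obtain y where y: "y \<in> A.star \<tau>" "A.adj t y" "k y" by blast
        have "idx y < n" using y below[OF y(1)] t A.idx_neq[OF y(2)] by simp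
        then have "x \<in> F y" using kG[rule_format, OF inN(1)[OF y(1)] _ \<alpha>[OF y(1,2)]] y(3) by blast
        \<comment> \<open>Both fail: \<open>z\<close> is not adjacent to \<open>t\<close>, and
          \<open>k\<close> is false at \<open>w\<close>.\<close>
        then have "y = z \<or> y = w" using ends[OF w(2) x(2) y(1)] by blast
        then show False using kz(2) y False by blast
      qed
      then show ?thesis using relabel_eq_iff_on_ridge[OF w(2) x(2,1)] IH by simp
    qed
  qed
  show ?thesis unfolding flat_def
  proof (intro allI impI)
    fix y w x assume *: "y \<in> A.star \<tau>" "w \<in> A.star \<tau>" "A.adj y w" "x \<notin> \<tau>" "F y \<inter> F w = insert x \<tau>"
    show "relabel y x = relabel w x"
      using relabel_eq_iff_on_ridge[OF *(3,5,4)] all[OF *(1)] all[OF *(2)] by simp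
  qed
qed

text \<open>If the facet at position \<open>n\<close> belongs to the star, it is the last one there
  and \<open>flat_at_sink\<close> applies; otherwise the bound drops to \<open>n\<close>.\<close>

lemma flat_below: "flat_below n"
proof (induction n)
  case 0
  show ?case unfolding flat_below_def flat_def by simp
next
  case (Suc n)
  show ?case unfolding flat_below_def
  proof (intro allI impI)
    fix \<tau> assume \<tau>: "card \<tau> + 2 = d" "\<forall>y\<in>A.star \<tau>. idx y < Suc n"
    show "flat \<tau>"
    proof (cases "\<exists>t\<in>A.star \<tau>. idx t = n")
      case True
      then show ?thesis using flat_at_sink[OF Suc _ _ \<tau>(1)] \<tau>(2) by (meson less_Suc_eq_le)
    next
      case False
      then have "\<forall>y\<in>A.star \<tau>. idx y < n" using \<tau>(2) less_Suc_eq by blast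
      then show ?thesis using Suc \<tau>(1) unfolding flat_below_def by blast
    qed
  qed
qed

section \<open>From agreement across ridges to a bijection of the vertices\<close>

lemma relabel_adj_eq:
  assumes "A.adj y w" "x \<in> F y" "x \<in> F w"
  shows "relabel y x = relabel w x"
proof -
  define \<tau> where "\<tau> = F y \<inter> F w - {x}"
  have N: "y \<in> N" "w \<in> N" using assms A.adj_in_N by auto
  have "card \<tau> + 1 = card (F y \<inter> F w)"
    using card_Suc_Diff1[of "F y \<inter> F w" x] A.finite_F[OF N(1)] assms unfolding \<tau>_def by simp
  then have c: "card \<tau> + 2 = d" using assms(1) by (simp add: A.adj_def)
  obtain m where "\<forall>y\<in>N. idx y < m"
    using A.finite_N by (metis finite_imageI finite_nat_set_iff_bounded imageI)
  then have "flat \<tau>" using flat_below[of m] c unfolding flat_below_def A.star_def by blast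
  moreover have "y \<in> A.star \<tau>" "w \<in> A.star \<tau>" "F y \<inter> F w = insert x \<tau>" "x \<notin> \<tau>"
    using N assms by (auto simp: A.star_def \<tau>_def)
  ultimately show ?thesis using assms(1) unfolding flat_def by blast
qed

text \<open>Vertex stars of the first system are connected by the shelling, which makes the map well
  defined; those of the second are connected by \<open>vertex_descent\<close>, which makes it
  injective.\<close>

theorem ex_vertex_bijection:
  "\<exists>g. bij_betw g (\<Union>(F ` N)) (\<Union>(G ` N)) \<and> (\<forall>y\<in>N. g ` F y = G y)"
proof -
  have same: "relabel y v = relabel z v" if "y \<in> N" "z \<in> N" "v \<in> F y" "v \<in> F z" for y z v
  proof (rule const_by_descent[where g = "\<lambda>y. relabel y v" and S = "{y \<in> N. v \<in> F y}" and idx = idx and R = A.adj])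
    show "inj_on idx {y \<in> N. v \<in> F y}" using A.inj_idx by (rule inj_on_subset) auto
  next
    fix u z assume "u \<in> {y \<in> N. v \<in> F y}" "z \<in> {y \<in> N. v \<in> F y}" "idx z < idx u"
    then show "\<exists>w\<in>{y \<in> N. v \<in> F y}. A.adj u w \<and> idx w < idx u"
      using A.shelling_step[of u z "{v}"] A.adj_in_N by fastforce
  next
    fix u w assume "u \<in> {y \<in> N. v \<in> F y}" "w \<in> {y \<in> N. v \<in> F y}" "A.adj u w"
    then show "relabel u v = relabel w v" using relabel_adj_eq by blast
  qed (use that in auto)
  have same_inv: "inv_into (F y) (relabel y) \<alpha> = inv_into (F z) (relabel z) \<alpha>"
    if "y \<in> N" "z \<in> N" "\<alpha> \<in> G y" "\<alpha> \<in> G z" for y z \<alpha>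
  proof (rule const_by_descent[where g = "\<lambda>y. inv_into (F y) (relabel y) \<alpha>"
        and S = "{y \<in> N. \<alpha> \<in> G y}" and idx = idx and R = A.adj])
    show "inj_on idx {y \<in> N. \<alpha> \<in> G y}" using A.inj_idx by (rule inj_on_subset) auto
  next
    fix u z assume "u \<in> {y \<in> N. \<alpha> \<in> G y}" "z \<in> {y \<in> N. \<alpha> \<in> G y}" "idx z < idx u"
    then show "\<exists>w\<in>{y \<in> N. \<alpha> \<in> G y}. A.adj u w \<and> idx w < idx u"
      using vertex_descent[of u z \<alpha>] A.adj_in_N by fastforce
  next
    fix u w assume uw: "u \<in> {y \<in> N. \<alpha> \<in> G y}" "w \<in> {y \<in> N. \<alpha> \<in> G y}" "A.adj u w"
    then obtain v where v: "v \<in> F u" "relabel u v = \<alpha>" using relabel_surj by blast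
    then have "v \<in> F w" using relabel_in_adj_iff[OF uw(3) v(1)] uw by simp
    moreover have "relabel w v = \<alpha>" using relabel_adj_eq[OF uw(3) v(1) \<open>v \<in> F w\<close>] v by simp
    moreover have "u \<in> N" "w \<in> N" using uw by auto
    ultimately show "inv_into (F u) (relabel u) \<alpha> = inv_into (F w) (relabel w) \<alpha>"
      using v bij_betw_inv_into_left[OF bij_relabel, of u v] bij_betw_inv_into_left[OF bij_relabel, of w v]
      by simp
  qed (use that in auto)
  define g where "g v = relabel (SOME y. y \<in> N \<and> v \<in> F y) v" for v
  have g: "g v = relabel y v" if "y \<in> N" "v \<in> F y" for y v
    unfolding g_def using someI[of "\<lambda>y. y \<in> N \<and> v \<in> F y" y] same that by blast
  have gF: "g ` F y = G y" if "y \<in> N" for y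
    using bij_relabel[OF that] g[OF that] image_cong[OF refl, of "F y" g "relabel y"]
    by (simp add: bij_betw_def)
  moreover have "inj_on g (\<Union>(F ` N))"
  proof (rule inj_onI)
    fix u v assume "u \<in> \<Union>(F ` N)" "v \<in> \<Union>(F ` N)" and eq: "g u = g v"
    then obtain y z where yz: "y \<in> N" "u \<in> F y" "z \<in> N" "v \<in> F z" by blast
    then have "relabel y u = relabel z v" using g eq by metis
    moreover have "relabel y u \<in> G y" "relabel z v \<in> G z" using yz relabel_in by auto
    ultimately show "u = v"
      using same_inv[of y z "relabel y u"] yz bij_betw_inv_into_left[OF bij_relabel, of y u]
        bij_betw_inv_into_left[OF bij_relabel, of z v] by simp
  qed
  moreover have "g ` (\<Union>(F ` N)) = \<Union>(G ` N)" using gF by (auto simp: image_UN)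
  ultimately show ?thesis unfolding bij_betw_def by blast
qed

end

section \<open>Reconstruction of shellable spheres\<close>

text \<open>The enumeration \<open>e\<close> is arbitrary, so that the second sphere can be indexed
  by the facets of the first.\<close>

lemma sphere_facet_system:
  assumes sphere: "simplicial_sphere V \<Delta>" and pure: "pure_card \<Delta> d"
    and e: "bij_betw e N (facets \<Delta>)"
  shows "facet_system N e d"
proof
  have sc: "finite V" "\<And>\<sigma>. \<sigma> \<in> \<Delta> \<Longrightarrow> \<sigma> \<subseteq> V"
    using sphere by (auto simp: simplicial_sphere_def simplicial_complex_def)
  have "\<Delta> \<subseteq> Pow V" using sc(2) by blast
  then have "finite (facets \<Delta>)" using sc(1) by (auto simp: facets_def intro: finite_subset)
  then show "finite N" using bij_betw_finite[OF e] by simp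
  show "inj_on e N" using e by (simp add: bij_betw_def)
  fix y assume y: "y \<in> N"
  then have ey: "e y \<in> facets \<Delta>" using e bij_betwE by blast
  then show "finite (e y)" using sc by (auto simp: facets_def intro: finite_subset)
  show "card (e y) = d" using pure ey by (simp add: pure_card_def)
  fix v assume "v \<in> e y"
  then obtain U where U: "U \<in> facets \<Delta>" "U \<noteq> e y" "e y - {v} \<subseteq> U"
    and uniq: "\<And>U'. U' \<in> facets \<Delta> \<Longrightarrow> U' \<noteq> e y \<Longrightarrow> e y - {v} \<subseteq> U' \<Longrightarrow> U' = U"
    using sphere_facet_across_ridge[OF sphere ey] by metis
  obtain w where w: "w \<in> N" "e w = U" using U(1) e by (metis bij_betw_def imageE)
  show "\<exists>!w. w \<in> N \<and> w \<noteq> y \<and> e y - {v} \<subseteq> e w"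
  proof (rule ex1I[of _ w])
    show "w \<in> N \<and> w \<noteq> y \<and> e y - {v} \<subseteq> e w" using w U by auto
    fix z assume z: "z \<in> N \<and> z \<noteq> y \<and> e y - {v} \<subseteq> e z"
    then have "e z \<noteq> e y" "e z \<in> facets \<Delta>" using e y by (auto simp: bij_betw_def inj_on_def)
    then have "e z = e w" using uniq z w by blast
    then show "z = w" using e z w by (auto simp: bij_betw_def inj_on_def)
  qed
qed

lemma facet_system_adj_iff_fr_adj:
  assumes "facet_system N e d" "bij_betw e N (facets \<Delta>)" "y \<in> N" "w \<in> N"
  shows "facet_system.adj N e d y w \<longleftrightarrow> fr_adj \<Delta> (e y) (e w)"
proof -
  interpret facet_system N e d by fact
  have "e y = e w \<longleftrightarrow> y = w" "e y \<in> facets \<Delta>" "e w \<in> facets \<Delta>"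
    using assms(2-4) by (auto simp: bij_betw_def inj_on_def)
  then show ?thesis using assms(3,4) card_F by (simp add: adj_def fr_adj_def)
qed

lemma sphere_shelled_facet_system:
  assumes sphere: "simplicial_sphere V \<Delta>" and pure: "pure_card \<Delta> d"
    and Ts: "shelling \<Delta> d Ts" "d \<ge> 1" and e: "bij_betw e N (facets \<Delta>)"
  obtains idx where "shelled_facet_system N e d idx"
proof -
  interpret facet_system N e d by (rule sphere_facet_system[OF sphere pure e])
  have dist: "distinct Ts" and set: "set Ts = facets \<Delta>"
    and step: "\<And>i. 1 \<le> i \<Longrightarrow> i < length Ts \<Longrightarrow>
      pure_card (closure_face (Ts ! i) \<inter> (\<Union>j<i. closure_face (Ts ! j))) (d - 1)"
    using Ts(1) by (auto simp: shelling_def)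
  define idx where "idx y = inv_into {..<length Ts} ((!) Ts) (e y)" for y
  have bij: "bij_betw ((!) Ts) {..<length Ts} (facets \<Delta>)"
    using bij_betw_nth[OF dist refl set[symmetric]] .
  have idx: "idx y < length Ts" "Ts ! idx y = e y" if "y \<in> N" for y
  proof -
    have ey: "e y \<in> (!) Ts ` {..<length Ts}" using that bij e by (auto simp: bij_betw_def)
    show "idx y < length Ts" using inv_into_into[OF ey] by (simp add: idx_def)
    show "Ts ! idx y = e y" using f_inv_into_f[OF ey] by (simp add: idx_def)
  qed
  have "shelled_facet_system N e d idx"
  proof
    show "inj_on idx N"
    proof (rule inj_onI)
      fix y w assume "y \<in> N" "w \<in> N" "idx y = idx w"
      then show "y = w" using idx inj_F by (metis inj_onD)
    qed
    fix y z \<sigma> assume y: "y \<in> N" and z: "z \<in> N" and less: "idx z < idx y"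
      and \<sigma>: "\<sigma> \<subseteq> e y" "\<sigma> \<subseteq> e z"
    define K where "K = closure_face (e y) \<inter> (\<Union>j<idx y. closure_face (Ts ! j))"
    have pK: "pure_card K (d - 1)" unfolding K_def using step[of "idx y"] idx[OF y] less by simp
    have "\<sigma> \<in> K" using \<sigma> less idx[OF z] by (auto simp: K_def closure_face_def)
    moreover have "finite K" using finite_F[OF y] by (simp add: K_def closure_face_def)
    \<comment> \<open>A maximal face of the intersection above \<sigma>: purity makes it a ridge,
      and it lies in an earlier facet.\<close>
    ultimately obtain \<rho> where \<rho>: "\<rho> \<in> K" "\<sigma> \<subseteq> \<rho>" "\<forall>\<tau>\<in>K. \<rho> \<subseteq> \<tau> \<longrightarrow> \<tau> = \<rho>"
      using finite_has_maximal2[of K \<sigma>] by metis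
    then have "card \<rho> = d - 1" using pK by (auto simp: pure_card_def facets_def)
    obtain j where j: "j < idx y" "\<rho> \<subseteq> e y" "\<rho> \<subseteq> Ts ! j"
      using \<rho>(1) by (auto simp: K_def closure_face_def)
    have "j < length Ts" using j(1) idx[OF y] by simp
    then have "Ts ! j \<in> facets \<Delta>" using set nth_mem by blast
    then obtain w where w: "w \<in> N" "e w = Ts ! j" using e by (metis bij_betw_def imageE)
    have "idx w = j" using idx[OF w(1)] w(2) dist \<open>j < length Ts\<close> by (simp add: nth_eq_iff_index_eq)
    then have "w \<noteq> y" using j(1) by auto
    have "card (e y \<inter> e w) \<noteq> d"
    proof
      assume "card (e y \<inter> e w) = d"
      then have "e y \<inter> e w = e y" using card_subset_eq[of "e y" "e y \<inter> e w"] finite_F[OF y] card_F[OF y] by simp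
      then show False using facet_subset_imp_eq[OF y w(1)] \<open>w \<noteq> y\<close> by blast
    qed
    moreover have "card (e y \<inter> e w) \<le> d"
      using card_mono[of "e y" "e y \<inter> e w"] finite_F[OF y] card_F[OF y] by simp
    moreover have "d - 1 \<le> card (e y \<inter> e w)"
      using card_mono[of "e y \<inter> e w" \<rho>] finite_F[OF y] j w \<open>card \<rho> = d - 1\<close> by simp
    ultimately have "adj y w" using y w \<open>w \<noteq> y\<close> Ts(2) by (simp add: adj_def)
    then show "\<exists>w. adj y w \<and> idx w < idx y \<and> \<sigma> \<subseteq> e w"
      using \<open>idx w = j\<close> j w \<rho>(2) by (metis subset_trans)
  qed
  then show ?thesis using that by blast
qed

lemma Union_facets:
  assumes "simplicial_complex V \<Delta>"
  shows "\<Union>(facets \<Delta>) = V"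
proof
  show "\<Union>(facets \<Delta>) \<subseteq> V" using assms by (auto simp: simplicial_complex_def facets_def)
  show "V \<subseteq> \<Union>(facets \<Delta>)"
  proof
    fix v assume "v \<in> V"
    then have "{v} \<in> \<Delta>" using assms by (simp add: simplicial_complex_def)
    then obtain T where "T \<in> facets \<Delta>" "{v} \<subseteq> T" using ex_facet_superset[OF assms] by blast
    then show "v \<in> \<Union>(facets \<Delta>)" by blast
  qed
qed

text \<open>Faces are exactly the subsets of facets, so matching the facets suffices.\<close>

lemma complex_isoI:
  assumes sc: "simplicial_complex V \<Delta>" and sc': "simplicial_complex V' \<Delta>'"
    and f: "bij_betw f (facets \<Delta>) (facets \<Delta>')"
    and g: "bij_betw g V V'" "\<And>T. T \<in> facets \<Delta> \<Longrightarrow> g ` T = f T"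
  shows "complex_iso V \<Delta> V' \<Delta>'"
  unfolding complex_iso_def
proof (intro exI conjI)
  have down: "\<sigma> \<in> \<Delta>" if "T \<in> facets \<Delta>" "\<sigma> \<subseteq> T" for \<sigma> T
    using sc that by (auto simp: simplicial_complex_def facets_def)
  have down': "\<sigma> \<in> \<Delta>'" if "T \<in> facets \<Delta>'" "\<sigma> \<subseteq> T" for \<sigma> T
    using sc' that by (auto simp: simplicial_complex_def facets_def)
  show "(`) g ` \<Delta> = \<Delta>'"
  proof (intro subset_antisym subsetI)
    fix \<sigma>' assume "\<sigma>' \<in> (`) g ` \<Delta>"
    then obtain \<sigma> where \<sigma>: "\<sigma> \<in> \<Delta>" "\<sigma>' = g ` \<sigma>" by blast
    obtain T where T: "T \<in> facets \<Delta>" "\<sigma> \<subseteq> T" using ex_facet_superset[OF sc \<sigma>(1)] .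
    then have "f T \<in> facets \<Delta>'" "\<sigma>' \<subseteq> f T" using f g(2)[OF T(1)] \<sigma> bij_betwE by blast+
    then show "\<sigma>' \<in> \<Delta>'" using down' by blast
  next
    fix \<sigma>' assume "\<sigma>' \<in> \<Delta>'"
    then obtain T' where T': "T' \<in> facets \<Delta>'" "\<sigma>' \<subseteq> T'" using ex_facet_superset[OF sc'] by blast
    then obtain T where T: "T \<in> facets \<Delta>" "T' = f T" using f by (metis bij_betw_def imageE)
    then obtain \<sigma> where "\<sigma> \<subseteq> T" "\<sigma>' = g ` \<sigma>" using T' g(2) by (metis subset_imageE)
    then show "\<sigma>' \<in> (`) g ` \<Delta>" using down T by blast
  qed
qed (rule g(1))

theorem theorem1p2:
  fixes V :: "'a set" and \<Delta> :: "'a set set" and V' :: "'b set" and \<Delta>' :: "'b set set"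
  assumes "simplicial_sphere V \<Delta>" and "shellable \<Delta>"
    and "simplicial_sphere V' \<Delta>'" and "shellable \<Delta>'"
    and "fr_graph_iso \<Delta> \<Delta>'"
  shows "complex_iso V \<Delta> V' \<Delta>'"
proof -
  have sc: "simplicial_complex V \<Delta>" and sc': "simplicial_complex V' \<Delta>'"
    using assms(1,3) by (auto simp: simplicial_sphere_def)
  obtain f where f: "bij_betw f (facets \<Delta>) (facets \<Delta>')"
    and f_adj: "\<forall>T\<in>facets \<Delta>. \<forall>U\<in>facets \<Delta>. fr_adj \<Delta> T U \<longleftrightarrow> fr_adj \<Delta>' (f T) (f U)"
    using assms(5) by (auto simp: fr_graph_iso_def)
  define N where "N = facets \<Delta>"
  \<comment> \<open>The nodes are the facets of the first sphere; \<open>f\<close> assigns their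
    partners.\<close>
  have id: "bij_betw (\<lambda>T. T) N (facets \<Delta>)" and fN: "bij_betw f N (facets \<Delta>')"
    using f by (auto simp: N_def bij_betw_def)
  show ?thesis
  proof (cases "N = {}")
    case True
    then have "V = {}" "V' = {}"
      using Union_facets[OF sc] Union_facets[OF sc'] f by (auto simp: N_def bij_betw_def)
    then have "bij_betw undefined V V'" by (simp add: bij_betw_def)
    then show ?thesis
      using True complex_isoI[OF sc sc' f] by (simp add: N_def)
  next
    case False
    obtain d Ts where d: "d \<ge> 1" "pure_card \<Delta> d" "shelling \<Delta> d Ts"
      using assms(2) by (auto simp: shellable_def)
    obtain d' Ts' where d': "d' \<ge> 1" "pure_card \<Delta>' d'" "shelling \<Delta>' d' Ts'"
      using assms(4) by (auto simp: shellable_def)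
    obtain idx where A: "shelled_facet_system N (\<lambda>T. T) d idx"
      using sphere_shelled_facet_system[OF assms(1) d(2,3,1) id] .
    obtain idx' where B: "shelled_facet_system N f d' idx'"
      using sphere_shelled_facet_system[OF assms(3) d'(2,3,1) fN] .
    interpret A: shelled_facet_system N "\<lambda>T. T" d idx by (rule A)
    interpret B: shelled_facet_system N f d' idx' by (rule B)
    have adj: "B.adj T U \<longleftrightarrow> A.adj T U" for T U
    proof (cases "T \<in> N \<and> U \<in> N")
      case True
      then show ?thesis
        using facet_system_adj_iff_fr_adj[OF A.facet_system_axioms id]
          facet_system_adj_iff_fr_adj[OF B.facet_system_axioms fN] f_adj by (simp add: N_def)
    next
      case False
      then show ?thesis by (auto simp: A.adj_def B.adj_def)
    qed
    obtain T where "T \<in> N" using False by blast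
    \<comment> \<open>The degree of a node is the number of vertices of its facet, so the graph
      determines the dimension.\<close>
    then have "card T = card (f T)"
      using bij_betw_same_card[OF A.bij_betw_across] bij_betw_same_card[OF B.bij_betw_across]
      by (simp add: adj)
    then have "d' = d" using A.card_F B.card_F \<open>T \<in> N\<close> by simp
    have "facet_pair N (\<lambda>T. T) d idx f"
    proof (intro facet_pair.intro facet_pair_axioms.intro)
      show "shelled_facet_system N (\<lambda>T. T) d idx" by (rule A)
      show "facet_system N f d" using B.facet_system_axioms \<open>d' = d\<close> by simp
      show "facet_system.adj N f d y w \<longleftrightarrow> facet_system.adj N (\<lambda>T. T) d y w" for y w
        using adj \<open>d' = d\<close> by simp
      show "\<exists>w. facet_system.adj N (\<lambda>T. T) d y w \<and> idx w < idx y \<and> \<alpha> \<in> f w"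
        if "y \<in> N" "z \<in> N" "idx z < idx y" "\<alpha> \<in> f y" "\<alpha> \<in> f z" for y z \<alpha>
        using vertex_descent_transfer[OF A, of f idx' y z \<alpha>] B adj that \<open>d' = d\<close> by blast
    qed
    from facet_pair.ex_vertex_bijection[OF this]
    obtain g where g: "bij_betw g (\<Union>((\<lambda>T. T) ` N)) (\<Union>(f ` N))" "\<forall>T\<in>N. g ` T = f T"
      by blast
    have "bij_betw g V V'"
      using g(1) Union_facets[OF sc] Union_facets[OF sc'] fN by (simp add: N_def bij_betw_def)
    then show ?thesis using complex_isoI[OF sc sc' f] g(2) by (simp add: N_def)
  qed
qed

end
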